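(* Let $T\subset\mathbb{R}^n$ be a hyperplane perpendicular to $\mathbf{e}$, let $\Sigma$ be the open half-space on one side of $T$, and let $\tilde x$ denote the reflection of $x$ with respect to $T$. Let $\Omega$ be a bounded open set in $\Sigma$ which is contained in the region between $T$ and $T_\Omega$, where $T_\Omega$ is a hyperplane parallel to $T$, and let $d(\Omega):=\mathrm{dist}(T,T_\Omega)$. Suppose that $w\in\mathcal{L}_s(\mathbb{R}^n)\cap C^{1,1}_{loc}(\Omega)$ is lower semi-continuous on $\overline\Omega$ and satisfies $$\begin{cases}\mathbf{F_s}w(x)-c(x)w(x)\le 0 & \text{at points } x\in\Omega \text{ where } w(x)<0,\\ w(x)\ge 0 & \text{in } \Sigma\setminus\Omega,\\ w(\tilde x)=-w(x) & \text{in } \Sigma,\end{cases}$$ where $c(x)$ is uniformly bounded from below (w.r.t. $d(\Omega)$) in $\{x\in\Omega : w(x)<0\}$. There exists a constant $C_{n,s,\theta}>0$ (depending only on $n,s,\theta$) such that, if $\Omega$ is narrow in the sense that $$d(\Omega)^{2s}\left(-\inf_{\{x\in\Omega : w(x)<0\}}c(x)\right)<C_{n,s,\theta},$$ then $w(x)\ge 0$ in $\Omega$. Furthermore, assume in addition that $\mathbf{F_s}w(x)\le 0$ at points $x\in\Omega$ where $w(x)=0$. Then either $w>0$ in $\Omega$ or $w=0$ almost everywhere in $\mathbb{R}^n$. These conclusions hold for unbounded open sets $\Omega$ if one further assumes that $\liminf_{|x|\to\infty}w(x)\ge 0$.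
   Context: Let $n\ge 2$, $0<s<1$ and $0<\theta\le\Theta<\infty$. $\mathcal{L}_s(\mathbb{R}^n)$ is the set of functions $u:\mathbb{R}^n\to\mathbb{R}$ with $\int_{\mathbb{R}^n}\frac{|u(x)|}{1+|x|^{n+2s}}\,dx<+\infty$. $C^{1,1}_{loc}(\Omega)$ denotes functions that are $C^1$ with locally Lipschitz gradient in $\Omega$. Fix a unit vector $\mathbf{e}\in\mathbb{R}^n$. For $u\in\mathcal{L}_s(\mathbb{R}^n)$ that is $C^{1,1}$ near $x$, $$\mathbf{F_s}u(x):=\inf\left\{P.V.\int_{\mathbb{R}^n}\frac{u(y)-u(x)}{|A^{-1}(y-x)|^{n+2s}}\,dy \;:\; A \text{ a real symmetric } n\times n \text{ matrix},\ \theta I\le A\le\Theta I,\ \mathbf{e} \text{ is an eigenvector of } A\right\}.$$ P.V. denotes the Cauchy principal value. *)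

theory Defs
  imports "HOL-Analysis.Analysis"
begin

(* The weighted space of (Lebesgue measurable) functions on R^n. Measurability has to be
   required separately, since only the absolute value of u enters the integral. *)
definition Ls_space :: "real \<Rightarrow> (real^'n \<Rightarrow> real) set" where
  "Ls_space s = {u. u \<in> borel_measurable lebesgue \<and>
     integrable lebesgue (\<lambda>x. \<bar>u x\<bar> / (1 + norm x powr (real CARD('n) + 2 * s)))}"

(* Continuity of the gradient g is implied by its being locally Lipschitz. *)
definition C11_loc :: "'a::euclidean_space set \<Rightarrow> ('a \<Rightarrow> real) set" where
  "C11_loc \<Omega> = {u. \<exists>g. (\<forall>x\<in>\<Omega>. GDERIV u x :> g x) \<and>
     (\<forall>x\<in>\<Omega>. \<exists>r>0. \<exists>L. L-lipschitz_on (ball x r \<inter> \<Omega>) g)}"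

(* Lower semicontinuity of the restriction of u to S. *)
definition lsc_on :: "'a::topological_space set \<Rightarrow> ('a \<Rightarrow> real) \<Rightarrow> bool" where
  "lsc_on S u \<longleftrightarrow> (\<forall>x\<in>S. \<forall>a<u x. eventually (\<lambda>y. a < u y) (at x within S))"

(* Cauchy principal value at the singularity x. The value is meaningful when the truncated
   integrals are absolutely convergent and converge to a limit, as is the case for the kernels
   below if u is in Ls_space and of class C^{1,1} near x. *)
definition PV_integral :: "('a::euclidean_space \<Rightarrow> real) \<Rightarrow> 'a \<Rightarrow> real" where
  "PV_integral f x =
     Lim (at_right 0) (\<lambda>\<epsilon>. set_lebesgue_integral lebesgue (- ball x \<epsilon>) f)"

(* Symmetric A with (theta I) <= A <= (Theta I) as quadratic forms and with e as an eigenvector. *)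
definition admissible_matrices :: "real \<Rightarrow> real \<Rightarrow> real^'n \<Rightarrow> (real^'n^'n) set" where
  "admissible_matrices \<theta> \<Theta> e = {A. transpose A = A \<and>
     (\<forall>v. \<theta> * (v \<bullet> v) \<le> v \<bullet> (A *v v) \<and> v \<bullet> (A *v v) \<le> \<Theta> * (v \<bullet> v)) \<and>
     e \<noteq> 0 \<and> (\<exists>\<mu>. A *v e = \<mu> *\<^sub>R e)}"

(* The infimum is the real-valued one. Where u is C^{1,1} near x and u is in Ls_space, the
   set is nonempty (for theta <= Theta) and bounded. *)
definition F_op :: "real \<Rightarrow> real \<Rightarrow> real \<Rightarrow> real^'n \<Rightarrow> (real^'n \<Rightarrow> real) \<Rightarrow> real^'n \<Rightarrow> real" where
  "F_op s \<theta> \<Theta> e u x = (INF A\<in>admissible_matrices \<theta> \<Theta> e.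
     PV_integral (\<lambda>y. (u y - u x) /
       norm (matrix_inv A *v (y - x)) powr (real CARD('n) + 2 * s)) x)"

definition hyperplane :: "'a::real_inner \<Rightarrow> real \<Rightarrow> 'a set" where
  "hyperplane e t = {x. e \<bullet> x = t}"

(* Reflection with respect to hyperplane e t; the formula is the right one for unit vectors e. *)
definition reflect :: "'a::real_inner \<Rightarrow> real \<Rightarrow> 'a \<Rightarrow> 'a" where
  "reflect e t x = x - (2 * (e \<bullet> x - t)) *\<^sub>R e"

(* The (closed) slab between hyperplane e t and hyperplane e t', with no order on t and t'. *)
definition region_between :: "'a::real_inner \<Rightarrow> real \<Rightarrow> real \<Rightarrow> 'a set" where
  "region_between e t t' = {x. e \<bullet> x \<in> closed_segment t t'}"

end

theory Submission
  imports Defs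
begin

text \<open>At a point \<open>z\<close> where \<open>w\<close> is negative and (almost) minimal over the half-space, folding the
  principal value integral onto the half-space shows that every admissible kernel contributes at least
  \<open>2 \<bar>w z\<bar>\<close> times its mass on the opposite half-space, hence at least a constant depending only on
  \<open>n\<close>, \<open>s\<close>, \<open>\<theta>\<close> times \<open>\<bar>w z\<bar>\<close> over the \<open>2 s\<close>-th power of the distance from \<open>z\<close> to the hyperplane.
  In a narrow region this contradicts the differential inequality. If \<open>w \<ge> 0\<close> vanishes at a point of
  \<open>\<Omega>\<close>, the same folding shows that the operator dominates there the integral of \<open>w\<close> against a positive
  weight, which forces \<open>w = 0\<close> almost everywhere.\<close>

section \<open>Isometries of Lebesgue measure and lower semicontinuity\<close>

text \<open>The eigenvector condition makes the folding work: with y' the reflection of y and \<mu>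
  the eigenvalue of e, the square of |A^{-1}(y' - z)| exceeds that of |A^{-1}(y - z)| by 4 (e.y -
  t)(e.z - t) / \<mu>^2. So for y and z in the half-space every admissible kernel is smaller at y' -
  z than at y - z. The two half-spaces are recombined only after the principal value has become an
  absolutely convergent integral. The constant is \<theta>^q \<omega>_n 3^(-q), with q = n + 2s and
  \<omega>_n the volume of the unit ball: the kernel is at least \<theta>^q |h|^(-q), and across the
  hyperplane there is a ball of radius r within distance 3r of z, where r is the distance from z to
  the hyperplane. \<Theta> enters only the upper bounds for the errors made at an almost minimum.
  These carry a small factor \<delta> that can be chosen after \<Theta>, and the factor 2 in the
  gain leaves room for them; hence the constant is independent of \<Theta>. Every estimate is
  uniform in A, as the infimum over A need not be attained.\<close>

text \<open>Evaluating the double integral of \<open>1\<^sub>A (\<phi> x + y) * 1\<^sub>B y\<close>, \<open>B\<close> the unit ball, in both orders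
  compares the two measures by translation invariance alone.\<close>

lemma isometry_lborel:
  fixes f :: "'a::euclidean_space \<Rightarrow> 'a" and b :: 'a
  assumes f: "orthogonal_transformation f"
  defines "\<phi> \<equiv> \<lambda>x. b + f x"
  shows "distr lborel borel \<phi> = lborel"
proof (rule measure_eqI)
  fix A :: "'a set" assume "A \<in> sets (distr lborel borel \<phi>)"
  then have A[measurable]: "A \<in> sets borel" by simp
  obtain g where g: "orthogonal_transformation g" "\<And>x. f (g x) = x" "\<And>x. g (f x) = x"
    by (metis f orthogonal_transformation_inv orthogonal_transformation_bij bij_inv_eq_iff)
  have lin: "linear f" using f by (simp add: orthogonal_transformation_def)
  have cont: "continuous_on UNIV \<phi>"
    unfolding \<phi>_def using lin by (intro continuous_intros linear_continuous_on) (simp add: linear_linear)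
  have [measurable]: "\<phi> \<in> borel_measurable borel" by (rule borel_measurable_continuous_onI[OF cont])
  have [measurable]: "ball (0::'a) 1 \<in> sets borel" by simp
  define V where "V = emeasure lborel (ball (0::'a) 1)"
  have trans: "(\<integral>\<^sup>+x. h (x + a) \<partial>lborel) = (\<integral>\<^sup>+x. h x \<partial>lborel)"
    if [measurable]: "h \<in> borel_measurable borel" for h :: "'a \<Rightarrow> ennreal" and a
    by (subst (2) lborel_distr_plus[of a, symmetric]) (simp add: nn_integral_distr add.commute)
  have V: "0 < V" "V < \<infinity>"
    unfolding V_def by (simp_all add: emeasure_ball)
  have "emeasure lborel (\<phi> -` A) * V
      = (\<integral>\<^sup>+y. (\<integral>\<^sup>+x. indicator A (\<phi> x) \<partial>lborel) * indicator (ball (0::'a) 1) y \<partial>lborel)"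
  proof -
    have "\<phi> -` A \<in> sets borel" using measurable_sets[of \<phi> borel borel A] by simp
    then have "emeasure lborel (\<phi> -` A) = (\<integral>\<^sup>+x. indicator A (\<phi> x) \<partial>lborel)"
      by (simp flip: nn_integral_indicator add: indicator_vimage)
    then show ?thesis by (simp add: nn_integral_cmult_indicator V_def)
  qed
  also have "\<dots> = (\<integral>\<^sup>+y. (\<integral>\<^sup>+x. indicator A (\<phi> x + y) * indicator (ball 0 1) y \<partial>lborel) \<partial>lborel)"
  proof (intro nn_integral_cong)
    fix y
    \<comment> \<open>A translation of the target by y is a translation of the source by
      \<open>g y\<close>, so the inner integral does not depend on y.\<close>
    have "\<phi> x + y = \<phi> (x + g y)" for x by (simp add: \<phi>_def linear_add[OF lin] g)
    then have "(\<integral>\<^sup>+x. indicator A (\<phi> x + y) \<partial>lborel) = (\<integral>\<^sup>+x. (indicator A (\<phi> x) :: ennreal) \<partial>lborel)"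
      using trans[of "\<lambda>x. indicator A (\<phi> x)" "g y"] by simp
    then show "(\<integral>\<^sup>+x. indicator A (\<phi> x) \<partial>lborel) * indicator (ball 0 1) y
       = (\<integral>\<^sup>+x. indicator A (\<phi> x + y) * indicator (ball (0::'a) 1) y \<partial>lborel)"
      by (simp add: nn_integral_multc)
  qed
  also have "\<dots> = (\<integral>\<^sup>+x. (\<integral>\<^sup>+y. indicator A (\<phi> x + y) * indicator (ball 0 1) y \<partial>lborel) \<partial>lborel)"
    by (rule lborel_pair.Fubini') measurable
  also have "\<dots> = (\<integral>\<^sup>+x. (\<integral>\<^sup>+y. indicator A y * indicator (ball 0 1) (y - \<phi> x) \<partial>lborel) \<partial>lborel)"
  proof (rule nn_integral_cong)
    fix x :: 'a
    have "(\<integral>\<^sup>+y. indicator A (y + \<phi> x) * indicator (ball 0 1) (y + \<phi> x - \<phi> x) \<partial>lborel)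
        = (\<integral>\<^sup>+y. indicator A y * indicator (ball 0 1) (y - \<phi> x) \<partial>lborel)"
      by (rule trans) measurable
    then show "(\<integral>\<^sup>+y. indicator A (\<phi> x + y) * indicator (ball 0 1) y \<partial>lborel)
        = (\<integral>\<^sup>+y. indicator A y * indicator (ball 0 1) (y - \<phi> x) \<partial>lborel)"
      by (simp add: add.commute)
  qed
  also have "\<dots> = (\<integral>\<^sup>+y. (\<integral>\<^sup>+x. indicator A y * indicator (ball 0 1) (y - \<phi> x) \<partial>lborel) \<partial>lborel)"
    by (rule lborel_pair.Fubini') measurable
  also have "\<dots> = (\<integral>\<^sup>+y. indicator A y * V \<partial>lborel)"
  proof (intro nn_integral_cong)
    fix y
    \<comment> \<open>Preservation of the norm enters here: seen as a condition on x, membership in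
      the unit ball describes another unit ball, again of volume \<open>V\<close>.\<close>
    have "norm (y - \<phi> x) = norm (x - g (y - b))" for x
    proof -
      have "y - \<phi> x = - f (x - g (y - b))" by (simp add: \<phi>_def linear_diff[OF lin] g)
      then show ?thesis using f by (simp add: orthogonal_transformation_norm)
    qed
    then have "indicator (ball 0 1) (y - \<phi> x) = (indicator (ball (g (y - b)) 1) x :: ennreal)" for x
      by (simp add: indicator_def dist_norm norm_minus_commute)
    then show "(\<integral>\<^sup>+x. indicator A y * indicator (ball 0 1) (y - \<phi> x) \<partial>lborel) = indicator A y * V"
      by (simp add: nn_integral_cmult_indicator V_def emeasure_ball)
  qed
  also have "\<dots> = emeasure lborel A * V" by (simp add: nn_integral_multc)
  finally have "V * emeasure lborel (\<phi> -` A) = V * emeasure lborel A" by (simp only: mult.commute)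
  then have "emeasure lborel (\<phi> -` A) = emeasure lborel A"
    using V by (auto simp: ennreal_mult_cancel_left)
  then show "emeasure (distr lborel borel \<phi>) A = emeasure lborel A"
    by (simp add: emeasure_distr)
qed simp

text \<open>Since the image of \<open>lborel\<close> is \<open>lborel\<close>, null sets pull back
  to null sets, and both claims pass to the completion.\<close>

lemma
  fixes f :: "'a::euclidean_space \<Rightarrow> 'a"
  assumes f: "orthogonal_transformation f"
  shows isometry_lebesgue_measurable: "(\<lambda>x. b + f x) \<in> lebesgue \<rightarrow>\<^sub>M lebesgue"
    and isometry_lebesgue: "distr lebesgue lebesgue (\<lambda>x. b + f x) = lebesgue"
proof -
  let ?\<phi> = "\<lambda>x. b + f x"
  have lin: "linear f" using f by (simp add: orthogonal_transformation_def)
  have cont: "continuous_on UNIV ?\<phi>"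
    using lin by (intro continuous_intros linear_continuous_on) (simp add: linear_linear)
  have [measurable]: "?\<phi> \<in> lebesgue \<rightarrow>\<^sub>M borel" "?\<phi> \<in> borel \<rightarrow>\<^sub>M borel"
    using borel_measurable_continuous_onI[OF cont] by (auto intro: measurable_completion)
  have eq: "distr lebesgue lborel ?\<phi> = lborel"
    using isometry_lborel[OF f, of b] by (simp add: distr_completion cong: distr_cong)
  show m: "?\<phi> \<in> lebesgue \<rightarrow>\<^sub>M lebesgue"
    by (rule completion.measurable_completion2) (auto simp: eq)
  have "lebesgue = completion (distr lebesgue lborel ?\<phi>)" by (simp add: eq)
  also have "\<dots> = distr lebesgue lebesgue ?\<phi>"
    by (subst completion.completion_distr_eq) (auto simp: eq)
  finally show "distr lebesgue lebesgue ?\<phi> = lebesgue" ..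
qed

text \<open>If every x had a strictly better point \<open>v x\<close>, then \<open>u\<close> would
  exceed \<open>u (v x)\<close> on a neighbourhood of x. In a finite subcover take the x with least
  \<open>u (v x)\<close>: the point \<open>v x\<close> lies in some member \<open>U y\<close>, which
  forces \<open>u (v y) < u (v x)\<close>.\<close>

lemma lsc_on_attains_min:
  fixes u :: "'a::topological_space \<Rightarrow> real"
  assumes "compact S" "S \<noteq> {}" "lsc_on S u"
  obtains z where "z \<in> S" "\<And>y. y \<in> S \<Longrightarrow> u z \<le> u y"
proof -
  have "\<exists>z\<in>S. \<forall>y\<in>S. u z \<le> u y"
  proof (rule ccontr)
    assume "\<not> ?thesis"
    then obtain v where v: "\<And>x. x \<in> S \<Longrightarrow> v x \<in> S \<and> u (v x) < u x"
      by (metis not_le)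
    have "\<exists>U. open U \<and> x \<in> U \<and> (\<forall>y\<in>U \<inter> S. u (v x) < u y)" if "x \<in> S" for x
    proof -
      have "eventually (\<lambda>y. u (v x) < u y) (at x within S)"
        using assms(3) v[OF that] that unfolding lsc_on_def by blast
      then show ?thesis using v[OF that] by (auto simp: eventually_at_topological)
    qed
    then obtain U where U: "\<And>x. x \<in> S \<Longrightarrow> open (U x) \<and> x \<in> U x \<and> (\<forall>y\<in>U x \<inter> S. u (v x) < u y)"
      by metis
    obtain C where C: "C \<subseteq> S" "finite C" "S \<subseteq> (\<Union>x\<in>C. U x)"
      using compactE_image[OF assms(1), of S U] U by blast
    have "C \<noteq> {}" using C(3) assms(2) by auto
    then obtain x where x: "x \<in> C" "\<And>y. y \<in> C \<Longrightarrow> u (v x) \<le> u (v y)"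
      using arg_min_if_finite(1)[OF C(2), of "u \<circ> v"] arg_min_least[OF C(2), of _ "u \<circ> v"]
      by (metis comp_apply)
    obtain y where "y \<in> C" "v x \<in> U y" using C x(1) v by blast
    then have "u (v y) < u (v x)" using U[of y] v C(1) x(1) by blast
    then show False using x(2)[OF \<open>y \<in> C\<close>] by simp
  qed
  then show ?thesis using that by blast
qed

lemma lsc_on_add_continuous:
  fixes u \<phi> :: "'a::topological_space \<Rightarrow> real"
  assumes "lsc_on S u" "continuous_on S \<phi>"
  shows "lsc_on S (\<lambda>x. u x + \<phi> x)"
  unfolding lsc_on_def
proof (intro ballI allI impI)
  fix x a assume x: "x \<in> S" "a < u x + \<phi> x"
  define h where "h = (u x + \<phi> x - a) / 2"
  have "h > 0" using x by (simp add: h_def)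
  have "eventually (\<lambda>y. u x - h < u y) (at x within S)"
    using assms(1) x(1) \<open>h > 0\<close> unfolding lsc_on_def by simp
  moreover have "eventually (\<lambda>y. \<phi> x - h < \<phi> y) (at x within S)"
    using assms(2) x(1) \<open>h > 0\<close> unfolding continuous_on_def
    by (auto intro: order_tendstoD(1))
  ultimately show "eventually (\<lambda>y. a < u y + \<phi> y) (at x within S)"
    by eventually_elim (simp add: h_def field_simps)
qed

lemma lsc_on_subset: "lsc_on S u \<Longrightarrow> T \<subseteq> S \<Longrightarrow> lsc_on T u"
  unfolding lsc_on_def by (metis filter_leD at_le subsetD)

section \<open>Integrals of radial powers\<close>

text \<open>Serves two regimes: \<open>b = 2\<close> for the exterior of a ball,
  \<open>b = 1/2\<close> for a punctured ball. On the k-th shell the integrand is at most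
  \<open>(\<rho> * b ^ k) powr (- p)\<close>, and the shell lies in the ball of radius
  \<open>2 * (\<rho> * b ^ k)\<close>, so the bounds form a geometric series of ratio
  \<open>b powr (n - p)\<close>. The origin may be left uncovered because
  \<open>0 powr x = 0\<close>.\<close>

lemma radial_power_integral:
  fixes S :: "'a::euclidean_space set"
  assumes S[measurable]: "S \<in> sets lebesgue"
    and cover: "S - {0} \<subseteq> (\<Union>k. {h. \<rho> * b ^ k \<le> norm h \<and> norm h < 2 * (\<rho> * b ^ k)})"
    and "0 < \<rho>" "0 < b" "0 \<le> p" and b: "b powr (real DIM('a) - p) < 1"
  defines "c \<equiv> unit_ball_vol (real DIM('a)) * 2 ^ DIM('a) / (1 - b powr (real DIM('a) - p))"
  shows "integrable lebesgue (\<lambda>h. indicator S h * norm h powr (- p))"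
    and "(LINT h|lebesgue. indicator S h * norm h powr (- p)) \<le> c * \<rho> powr (real DIM('a) - p)"
proof -
  let ?n = "real DIM('a)"
  let ?\<omega> = "unit_ball_vol ?n"
  define t where "t k = (\<rho> * b ^ k) powr (- p)" for k
  have pos: "0 < \<rho> * b ^ k" for k using assms by simp
  have [measurable]: "ball (0::'a) r \<in> sets lebesgue" for r by simp
  have [measurable]: "(\<lambda>h::'a. norm h powr (- p)) \<in> borel_measurable lebesgue"
    by (rule measurable_completion) measurable
  have [measurable]: "(\<lambda>h. indicator S h * norm h powr (- p)) \<in> borel_measurable lebesgue"
    by measurable
  have ptw: "ennreal (indicator S h * norm h powr (- p))
      \<le> (\<Sum>k. ennreal (t k) * indicator (ball 0 (2 * (\<rho> * b ^ k))) h)" for h :: 'a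
  proof (cases "h \<in> S - {0}")
    case True
    then obtain k where k: "\<rho> * b ^ k \<le> norm h" "norm h < 2 * (\<rho> * b ^ k)"
      using cover by blast
    define F where "F j = ennreal (t j) * indicator (ball 0 (2 * (\<rho> * b ^ j))) h" for j
    have "indicator S h * norm h powr (- p) \<le> t k"
      using True k pos[of k] \<open>0 \<le> p\<close> by (auto simp: t_def intro!: powr_mono2')
    then have "ennreal (indicator S h * norm h powr (- p)) \<le> F k"
      using k by (simp add: F_def ennreal_leI)
    also have "\<dots> \<le> (\<Sum>j. F j)"
      using sum_le_suminf[of F "{k}"] by simp
    also have "\<dots> = (\<Sum>k. ennreal (t k) * indicator (ball 0 (2 * (\<rho> * b ^ k))) h)"
      by (simp only: F_def)
    finally show ?thesis .
  qed (auto simp: indicator_def)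
  have sums: "(\<lambda>k. t k * (?\<omega> * (2 * (\<rho> * b ^ k)) ^ DIM('a))) sums (c * \<rho> powr (?n - p))"
  proof -
    have "t k * (?\<omega> * (2 * (\<rho> * b ^ k)) ^ DIM('a))
        = (?\<omega> * 2 ^ DIM('a) * \<rho> powr (?n - p)) * (b powr (?n - p)) ^ k" for k
    proof -
      have "t k * (\<rho> * b ^ k) ^ DIM('a) = (\<rho> * b ^ k) powr (?n - p)"
        using pos[of k] by (simp add: t_def powr_minus powr_diff powr_realpow field_simps)
      also have "\<dots> = \<rho> powr (?n - p) * (b powr (?n - p)) ^ k"
        using assms(3,4) by (simp add: powr_mult powr_powr mult.commute flip: powr_realpow)
      finally have "t k * (\<rho> * b ^ k) ^ DIM('a) = \<rho> powr (?n - p) * (b powr (?n - p)) ^ k" .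
      then show ?thesis unfolding power_mult_distrib[of 2 "\<rho> * b ^ k"] by (simp only: mult.assoc mult.left_commute[of "t k"])
    qed
    moreover have "(\<lambda>k. (?\<omega> * 2 ^ DIM('a) * \<rho> powr (?n - p)) * (b powr (?n - p)) ^ k) sums
        ((?\<omega> * 2 ^ DIM('a) * \<rho> powr (?n - p)) * (1 / (1 - b powr (?n - p))))"
      using b by (intro sums_mult geometric_sums) simp
    ultimately show ?thesis by (simp only: c_def) (simp add: mult_ac)
  qed
  have "(\<integral>\<^sup>+h. ennreal (indicator S h * norm h powr (- p)) \<partial>lebesgue)
      \<le> (\<integral>\<^sup>+h. (\<Sum>k. ennreal (t k) * indicator (ball 0 (2 * (\<rho> * b ^ k))) (h::'a)) \<partial>lebesgue)"
    by (intro nn_integral_mono ptw)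
  also have "\<dots> = (\<Sum>k. \<integral>\<^sup>+h. ennreal (t k) * indicator (ball 0 (2 * (\<rho> * b ^ k))) (h::'a) \<partial>lebesgue)"
    by (rule nn_integral_suminf) measurable
  also have "\<dots> = (\<Sum>k. ennreal (t k * (?\<omega> * (2 * (\<rho> * b ^ k)) ^ DIM('a))))"
    using pos by (subst nn_integral_cmult_indicator)
      (auto simp: emeasure_ball less_imp_le t_def simp flip: ennreal_mult')
  also have "\<dots> = ennreal (c * \<rho> powr (?n - p))"
    using sums pos by (intro suminf_ennreal_eq) (auto simp: t_def less_imp_le)
  finally have le: "(\<integral>\<^sup>+h. ennreal (indicator S h * norm h powr (- p)) \<partial>lebesgue)
      \<le> ennreal (c * \<rho> powr (?n - p))" .
  show "integrable lebesgue (\<lambda>h. indicator S h * norm h powr (- p))"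
    using le_less_trans[OF le ennreal_less_top] by (intro integrableI_nonneg) (auto simp: infinity_ennreal_def)
  show "(LINT h|lebesgue. indicator S h * norm h powr (- p)) \<le> c * \<rho> powr (?n - p)"
    using le b by (intro integral_real_bounded) (auto simp: c_def)
qed

text \<open>What matters is the scaling with a constant that serves all radii: for q = n + 2s the
  bound is a multiple of \<rho>^(-2s), the same power as in the main term.\<close>

lemma radial_power_far:
  assumes q: "real DIM('a::euclidean_space) < q"
  obtains c where "0 \<le> c"
    "\<And>\<rho>. 0 < \<rho> \<Longrightarrow> integrable lebesgue (\<lambda>h::'a. indicator (- ball 0 \<rho>) h * norm h powr (- q))"
    "\<And>\<rho>. 0 < \<rho> \<Longrightarrow> (LINT h|lebesgue. indicator (- ball (0::'a) \<rho>) h * norm h powr (- q))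
        \<le> c * \<rho> powr (real DIM('a) - q)"
proof -
  define c where "c = unit_ball_vol (real DIM('a)) * 2 ^ DIM('a) / (1 - 2 powr (real DIM('a) - q))"
  have b: "2 powr (real DIM('a) - q) < 1" using q powr_less_mono[of "real DIM('a) - q" 0 2] by simp
  have cover: "- ball (0::'a) \<rho> - {0} \<subseteq> (\<Union>k. {h. \<rho> * 2 ^ k \<le> norm h \<and> norm h < 2 * (\<rho> * 2 ^ k)})"
    if \<rho>: "0 < \<rho>" for \<rho> :: real
  proof
    fix h :: 'a assume h: "h \<in> - ball 0 \<rho> - {0}"
    define k where "k = (LEAST k. norm h < 2 * (\<rho> * 2 ^ k))"
    obtain m where "norm h / \<rho> < 2 ^ m" using real_arch_pow[of 2 "norm h / \<rho>"] by auto
    then have "norm h < \<rho> * 2 ^ m" using \<rho> by (simp add: field_simps)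
    also have "\<dots> < 2 * (\<rho> * 2 ^ m)" using \<rho> by simp
    finally have "norm h < 2 * (\<rho> * 2 ^ m)" .
    then have k: "norm h < 2 * (\<rho> * 2 ^ k)" unfolding k_def by (rule LeastI)
    have "\<rho> * 2 ^ k \<le> norm h"
    proof (cases k)
      case 0 then show ?thesis using h by simp
    next
      case (Suc j)
      then have "\<not> norm h < 2 * (\<rho> * 2 ^ j)" unfolding k_def by (intro not_less_Least) simp
      then show ?thesis using Suc by simp
    qed
    with k show "h \<in> (\<Union>k. {h. \<rho> * 2 ^ k \<le> norm h \<and> norm h < 2 * (\<rho> * 2 ^ k)})" by blast
  qed
  show ?thesis
  proof (rule that[of c])
    show "0 \<le> c" using b by (simp add: c_def)
  next
    fix \<rho> :: real assume "0 < \<rho>"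
    note * = radial_power_integral[OF _ cover[OF this] this, of q]
    show "integrable lebesgue (\<lambda>h::'a. indicator (- ball 0 \<rho>) h * norm h powr (- q))"
      by (rule *(1)) (use q b in auto)
    show "(LINT h|lebesgue. indicator (- ball (0::'a) \<rho>) h * norm h powr (- q)) \<le> c * \<rho> powr (real DIM('a) - q)"
      unfolding c_def by (rule *(2)) (use q b in auto)
  qed
qed

lemma radial_power_near:
  assumes p: "0 \<le> p" "p < real DIM('a::euclidean_space)"
  obtains c where "0 \<le> c"
    "\<And>\<rho>. 0 < \<rho> \<Longrightarrow> integrable lebesgue (\<lambda>h::'a. indicator (ball 0 \<rho>) h * norm h powr (- p))"
    "\<And>\<rho>. 0 < \<rho> \<Longrightarrow> (LINT h|lebesgue. indicator (ball (0::'a) \<rho>) h * norm h powr (- p))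
        \<le> c * \<rho> powr (real DIM('a) - p)"
proof -
  define c where "c = unit_ball_vol (real DIM('a)) * 2 ^ DIM('a) / (1 - (1/2) powr (real DIM('a) - p))"
  have b: "(1/2) powr (real DIM('a) - p) < 1"
    using p powr_less_mono[of 0 "real DIM('a) - p" 2] by (simp add: powr_divide)
  have cover: "ball (0::'a) \<rho> - {0} \<subseteq> (\<Union>k. {h. \<rho> / 2 * (1/2) ^ k \<le> norm h \<and> norm h < 2 * (\<rho> / 2 * (1/2) ^ k)})"
    if \<rho>: "0 < \<rho>" for \<rho> :: real
  proof
    fix h :: 'a assume h: "h \<in> ball 0 \<rho> - {0}"
    define k where "k = (LEAST k. \<rho> / 2 * (1/2) ^ k \<le> norm h)"
    obtain m where "(1/2) ^ m < norm h / \<rho>"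
      using real_arch_pow_inv[of "norm h / \<rho>" "1/2"] h \<rho> by auto
    then have "\<rho> / 2 * (1/2) ^ m \<le> norm h" using \<rho> by (simp add: field_simps)
    then have k: "\<rho> / 2 * (1/2) ^ k \<le> norm h" unfolding k_def by (rule LeastI)
    have "norm h < 2 * (\<rho> / 2 * (1/2) ^ k)"
    proof (cases k)
      case 0 then show ?thesis using h by simp
    next
      case (Suc j)
      then have "\<not> \<rho> / 2 * (1/2) ^ j \<le> norm h" unfolding k_def by (intro not_less_Least) simp
      then show ?thesis using Suc by simp
    qed
    with k show "h \<in> (\<Union>k. {h. \<rho> / 2 * (1/2) ^ k \<le> norm h \<and> norm h < 2 * (\<rho> / 2 * (1/2) ^ k)})" by blast
  qed
  show ?thesis
  proof (rule that[of "c * (1/2) powr (real DIM('a) - p)"])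
    show "0 \<le> c * (1/2) powr (real DIM('a) - p)" using b by (simp add: c_def)
  next
    fix \<rho> :: real assume \<rho>: "0 < \<rho>"
    note * = radial_power_integral[OF _ cover[OF this], of p]
    show "integrable lebesgue (\<lambda>h::'a. indicator (ball 0 \<rho>) h * norm h powr (- p))"
      by (rule *(1)) (use p b \<rho> in auto)
    have "(LINT h|lebesgue. indicator (ball (0::'a) \<rho>) h * norm h powr (- p)) \<le> c * (\<rho> / 2) powr (real DIM('a) - p)"
      unfolding c_def by (rule *(2)) (use p b \<rho> in auto)
    also have "\<dots> = c * (1/2) powr (real DIM('a) - p) * \<rho> powr (real DIM('a) - p)"
      using \<rho> by (simp add: powr_divide)
    finally show "(LINT h|lebesgue. indicator (ball (0::'a) \<rho>) h * norm h powr (- p))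
        \<le> c * (1/2) powr (real DIM('a) - p) * \<rho> powr (real DIM('a) - p)" .
  qed
qed

section \<open>Admissible matrices\<close>

lemma inner_symmetric_matrix:
  fixes A :: "real^'n^'n"
  assumes "transpose A = A"
  shows "(A *v x) \<bullet> y = x \<bullet> (A *v y)"
  by (metis assms dot_lmul_matrix vector_transpose_matrix)

text \<open>Polarization takes the place of diagonalization. For x the positive multiple of
  \<open>A *v k\<close> with |x| = |k|, four times x.Ak is the form at x + k minus the form at x -
  k, hence at most \<Theta> |x + k|^2, which is at most 4 \<Theta> |k|^2; and x.Ak = |k|
  |Ak|.\<close>

lemma symmetric_matrix_norm_le:
  fixes A :: "real^'n^'n"
  assumes sym: "transpose A = A"
    and form: "\<And>v. 0 \<le> v \<bullet> (A *v v)" "\<And>v. v \<bullet> (A *v v) \<le> \<Theta> * (v \<bullet> v)"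
  shows "norm (A *v k) \<le> \<Theta> * norm k"
proof (cases "A *v k = 0 \<or> k = 0")
  case True
  show ?thesis
  proof (cases "k = 0")
    case False
    then have "0 \<le> \<Theta>"
      using order_trans[OF form(1) form(2), of k] by (auto simp: zero_le_mult_iff dest: antisym[OF _ inner_ge_zero])
    with True show ?thesis by auto
  qed auto
next
  case False
  define c where "c = norm k / norm (A *v k)"
  define x where "x = c *\<^sub>R (A *v k)"
  have c: "0 < c" "norm x = norm k" using False by (auto simp: c_def x_def)
  have "4 * (x \<bullet> (A *v k)) = (x + k) \<bullet> (A *v (x + k)) - (x - k) \<bullet> (A *v (x - k))"
    using inner_symmetric_matrix[OF sym, of x k]
    by (simp add: algebra_simps matrix_vector_right_distrib matrix_vector_mult_diff_distrib inner_commute)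
  also have "\<dots> \<le> \<Theta> * ((x + k) \<bullet> (x + k))" using form(1)[of "x - k"] form(2)[of "x + k"] by linarith
  finally have 1: "4 * (x \<bullet> (A *v k)) \<le> \<Theta> * (norm (x + k))\<^sup>2" by (simp add: power2_norm_eq_inner)
  have "0 \<le> \<Theta>"
    using order_trans[OF form(1) form(2), of k] False by (auto simp: zero_le_mult_iff dest: antisym[OF _ inner_ge_zero])
  moreover have "norm (x + k) \<le> 2 * norm k" using norm_triangle_ineq[of x k] c by simp
  ultimately have "\<Theta> * (norm (x + k))\<^sup>2 \<le> \<Theta> * (2 * norm k)\<^sup>2"
    by (intro mult_left_mono power_mono) auto
  with 1 have "x \<bullet> (A *v k) \<le> \<Theta> * (norm k)\<^sup>2" by (simp add: power_mult_distrib)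
  moreover have "x \<bullet> (A *v k) = norm k * norm (A *v k)"
    using False by (simp add: x_def c_def power2_norm_eq_inner[symmetric] power2_eq_square)
  ultimately show ?thesis using False by (simp add: power2_eq_square)
qed

text \<open>The last identity carries the eigenvector condition: \<open>B\<close> maps e to
  \<open>(1 / \<mu>) *\<^sub>R e\<close>. For h = y - z and \<beta> = e.y - t the shifted vector is
  the reflection of y minus z, and the correction becomes 4 (e.y - t)(e.z - t) / \<mu>^2.\<close>

lemma admissible_inverse:
  fixes A :: "real^'n^'n"
  assumes A: "A \<in> admissible_matrices \<theta> \<Theta> e" and "0 < \<theta>" "norm e = 1"
  defines "B \<equiv> matrix_inv A"
  obtains \<mu> where "\<theta> \<le> \<mu>" "\<mu> \<le> \<Theta>"
    "\<And>h. norm (B *v h) \<le> norm h / \<theta>" "\<And>h. norm h \<le> \<Theta> * norm (B *v h)"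
    "\<And>h \<beta>. (norm (B *v (h - (2 * \<beta>) *\<^sub>R e)))\<^sup>2 = (norm (B *v h))\<^sup>2 + 4 * (\<beta> * (\<beta> - e \<bullet> h)) / \<mu>\<^sup>2"
proof -
  have sym: "transpose A = A"
    and form: "\<And>v. \<theta> * (v \<bullet> v) \<le> v \<bullet> (A *v v)" "\<And>v. v \<bullet> (A *v v) \<le> \<Theta> * (v \<bullet> v)"
    using A by (auto simp: admissible_matrices_def)
  obtain \<mu> where \<mu>: "A *v e = \<mu> *\<^sub>R e" using A by (auto simp: admissible_matrices_def)
  have "e \<bullet> e = 1" using \<open>norm e = 1\<close> by (simp add: norm_eq_1)
  then have \<mu>_bounds: "\<theta> \<le> \<mu>" "\<mu> \<le> \<Theta>" using form[of e] \<mu> by auto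
  have "invertible A"
  proof -
    have "x = 0" if "A *v x = 0" for x
      using form(1)[of x] that \<open>0 < \<theta>\<close> by (auto simp: mult_le_0_iff dest: antisym[OF _ inner_ge_zero])
    then obtain B where "B ** A = mat 1" using matrix_left_invertible_ker by blast
    then show ?thesis by (metis invertible_def matrix_left_right_inverse)
  qed
  then have "A ** B = mat 1 \<and> B ** A = mat 1"
    unfolding B_def matrix_inv_def invertible_def by (rule someI_ex)
  then have AB: "A *v (B *v x) = x" "B *v (A *v x) = x" for x
    by (simp_all add: matrix_vector_mul_assoc)
  have Bsym: "(B *v x) \<bullet> y = x \<bullet> (B *v y)" for x y
    using inner_symmetric_matrix[OF sym, of "B *v x" "B *v y"] by (simp add: AB)
  have Be: "B *v e = (1 / \<mu>) *\<^sub>R e"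
  proof -
    have eq: "\<mu> *\<^sub>R (B *v e) = e" using AB(2)[of e] \<mu> by (simp add: matrix_vector_mult_scaleR)
    have "B *v e = (1 / \<mu>) *\<^sub>R (\<mu> *\<^sub>R (B *v e))" using \<mu>_bounds \<open>0 < \<theta>\<close> by simp
    then show ?thesis by (simp only: eq)
  qed
  show ?thesis
  proof (rule that[of \<mu>])
    fix h :: "real^'n" and \<beta> :: real
    let ?k = "B *v h"
    have "\<theta> * (norm ?k)\<^sup>2 \<le> ?k \<bullet> h"
      using form(1)[of ?k] by (simp add: AB power2_norm_eq_inner)
    also have "\<dots> \<le> norm ?k * norm h" by (rule norm_cauchy_schwarz)
    finally have "norm ?k * (\<theta> * norm ?k) \<le> norm ?k * norm h" by (simp add: power2_eq_square mult_ac)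
    then show "norm ?k \<le> norm h / \<theta>"
      using \<open>0 < \<theta>\<close> by (cases "?k = 0") (auto simp: field_simps)
    have "0 \<le> v \<bullet> (A *v v)" for v
      using form(1)[of v] \<open>0 < \<theta>\<close> by (meson inner_ge_zero less_imp_le mult_nonneg_nonneg order_trans)
    then show "norm h \<le> \<Theta> * norm ?k"
      using symmetric_matrix_norm_le[OF sym _ form(2), of ?k] by (simp add: AB)
    have "B *v (h - (2 * \<beta>) *\<^sub>R e) = ?k - (2 * \<beta> / \<mu>) *\<^sub>R e"
      by (simp add: matrix_vector_mult_diff_distrib matrix_vector_mult_scaleR Be)
    moreover have "?k \<bullet> e = (e \<bullet> h) / \<mu>" using Bsym[of h e] by (simp add: Be inner_commute)
    moreover have "(norm (?k - c *\<^sub>R e))\<^sup>2 = (norm ?k)\<^sup>2 - 2 * c * (?k \<bullet> e) + c\<^sup>2" for c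
      using \<open>e \<bullet> e = 1\<close>
      by (simp add: power2_norm_eq_inner inner_diff_left inner_diff_right inner_commute[of e ?k] power2_eq_square[of c] algebra_simps)
    ultimately show "(norm (B *v (h - (2 * \<beta>) *\<^sub>R e)))\<^sup>2
        = (norm ?k)\<^sup>2 + 4 * (\<beta> * (\<beta> - e \<bullet> h)) / \<mu>\<^sup>2"
      by (simp add: power2_eq_square diff_divide_distrib right_diff_distrib)
  qed (use \<mu>_bounds in auto)
qed

text \<open>Witnesses that the infimum in \<open>F_op\<close> ranges over a nonempty set.\<close>

lemma scaled_identity_admissible:
  fixes e :: "real^'n"
  assumes "\<theta> \<le> \<Theta>" "norm e = 1"
  shows "\<theta> *\<^sub>R mat 1 \<in> admissible_matrices \<theta> \<Theta> e"
proof -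
  have "(\<theta> *\<^sub>R mat 1) *v v = \<theta> *\<^sub>R v" for v :: "real^'n"
    by (simp add: scaleR_matrix_vector_assoc[symmetric])
  moreover have "transpose (\<theta> *\<^sub>R mat 1) = (\<theta> *\<^sub>R mat 1 :: real^'n^'n)"
    by (simp add: transpose_def mat_def vec_eq_iff)
  moreover have "\<theta> * (v \<bullet> v) \<le> \<Theta> * (v \<bullet> v)" for v :: "real^'n"
    using assms(1) by (intro mult_right_mono) auto
  ultimately show ?thesis using assms(2) by (auto simp: admissible_matrices_def)
qed

section \<open>Change of variables under isometries and translations\<close>

lemma
  fixes F :: "'a::euclidean_space \<Rightarrow> real" and f :: "'a \<Rightarrow> 'a"
  assumes f: "orthogonal_transformation f"
  shows integrable_isometry: "integrable lebesgue F \<Longrightarrow> integrable lebesgue (\<lambda>x. F (b + f x))"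
    and integral_isometry: "F \<in> borel_measurable lebesgue
      \<Longrightarrow> (LINT x|lebesgue. F (b + f x)) = (LINT x|lebesgue. F x)"
  using integrable_distr[OF isometry_lebesgue_measurable[OF f], where f = F]
    integral_distr[OF isometry_lebesgue_measurable[OF f], of F]
  by (simp_all add: isometry_lebesgue[OF f])

lemma
  fixes F :: "'a::euclidean_space \<Rightarrow> real"
  shows integrable_translate: "integrable lebesgue F \<Longrightarrow> integrable lebesgue (\<lambda>x. F (x - z))"
    and integral_translate: "F \<in> borel_measurable lebesgue
      \<Longrightarrow> (LINT x|lebesgue. F (x - z)) = (LINT x|lebesgue. F x)"
  using integrable_isometry[OF orthogonal_transformation_id, of F "- z"]
    integral_isometry[OF orthogonal_transformation_id, of F "- z"]
  by simp_all

section \<open>Principal values for singular kernels\<close>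

lemma measurable_ident_lebesgue [measurable]: "(\<lambda>x::'a::euclidean_space. x) \<in> borel_measurable lebesgue"
  by (rule measurable_completion) simp

lemma ball_lebesgue [measurable]: "ball (z::'a::euclidean_space) r \<in> sets lebesgue"
  by simp

text \<open>Abstracts the kernels |A^{-1}h|^(-q). The condition n < q makes the tail integrable, q <
  n + 2 makes the kernel integrable against |h|^2 near 0, and 2 \<le> q keeps the exponent q - 2
  nonnegative there.\<close>

locale singular_kernel =
  fixes K :: "'a::euclidean_space \<Rightarrow> real" and q \<alpha> \<beta> :: real
  assumes measurable_kernel [measurable]: "K \<in> borel_measurable borel"
    and even: "K (- h) = K h"
    and lower: "\<alpha> * norm h powr (- q) \<le> K h"
    and upper: "K h \<le> \<beta> * norm h powr (- q)"
    and order: "real DIM('a) < q" "q < real DIM('a) + 2" "2 \<le> q"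
    and lower_pos: "0 < \<alpha>"
begin

lemma nonneg: "0 \<le> K h"
  by (rule order_trans[OF _ lower]) (use lower_pos in simp)

lemma upper_nonneg: "0 \<le> \<beta>"
proof -
  obtain i :: 'a where "i \<in> Basis" using nonempty_Basis by blast
  then show ?thesis using order_trans[OF nonneg upper, of i] by simp
qed

text \<open>By \<open>0 powr x = 0\<close> the upper bound pins the value at the singularity to 0.
  Monotonicity of the kernel under reflection therefore has to exclude the point y = z.\<close>

lemma zero [simp]: "K 0 = 0"
  using nonneg[of 0] upper[of 0] by simp

lemma measurable_translate [measurable]:
  "(\<lambda>y. K (y - z)) \<in> borel_measurable lebesgue"
  by measurable

lemma integrable_far:
  assumes "0 < r"
  shows "integrable lebesgue (\<lambda>y. indicator (- ball z r) y * K (y - z))"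
proof -
  have "integrable lebesgue (\<lambda>h::'a. indicator (- ball 0 r) h * norm h powr (- q))"
    by (rule radial_power_far[OF order(1)]) (use assms in blast)
  then have "integrable lebesgue (\<lambda>y. \<beta> * (indicator (- ball 0 r) (y - z) * norm (y - z) powr (- q)))"
    by (intro integrable_mult_right integrable_translate[of "\<lambda>h. indicator (- ball 0 r) h * norm h powr (- q)"])
  then show ?thesis
  proof (rule Bochner_Integration.integrable_bound)
    show "AE y in lebesgue. norm (indicator (- ball z r) y * K (y - z))
        \<le> norm (\<beta> * (indicator (- ball 0 r) (y - z) * norm (y - z) powr (- q)))"
      using upper upper_nonneg nonneg
      by (auto intro!: AE_I2 simp: indicator_def dist_norm norm_minus_commute)
  qed measurable
qed

lemma square_upper: "(norm h)\<^sup>2 * K h \<le> \<beta> * norm h powr (- (q - 2))"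
proof (cases "h = 0")
  case False
  have "(norm h)\<^sup>2 * K h \<le> (norm h)\<^sup>2 * (\<beta> * norm h powr (- q))"
    by (intro mult_left_mono upper) simp
  also have "\<dots> = \<beta> * norm h powr (- (q - 2))"
    using False by (simp add: powr_diff powr_minus field_simps flip: powr_numeral)
  finally show ?thesis .
qed (use upper_nonneg in simp)

lemma integrable_near:
  assumes "0 < r"
  shows "integrable lebesgue (\<lambda>y. indicator (ball z r) y * (norm (y - z))\<^sup>2 * K (y - z))"
proof -
  have "0 \<le> q - 2" "q - 2 < real DIM('a)" using order by auto
  then have "integrable lebesgue (\<lambda>h::'a. indicator (ball 0 r) h * norm h powr (- (q - 2)))"
    by (rule radial_power_near) (use assms in blast)
  then have "integrable lebesgue (\<lambda>y. \<beta> * (indicator (ball 0 r) (y - z) * norm (y - z) powr (- (q - 2))))"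
    by (intro integrable_mult_right integrable_translate[of "\<lambda>h. indicator (ball 0 r) h * norm h powr (- (q - 2))"])
  then show ?thesis
  proof (rule Bochner_Integration.integrable_bound)
    show "AE y in lebesgue. norm (indicator (ball z r) y * (norm (y - z))\<^sup>2 * K (y - z))
        \<le> norm (\<beta> * (indicator (ball 0 r) (y - z) * norm (y - z) powr (- (q - 2))))"
      using square_upper upper_nonneg nonneg
      by (auto intro!: AE_I2 simp: indicator_def dist_norm norm_minus_commute)
  qed measurable
qed

end

text \<open>The difference quotient numerator, with the first-order part removed in a ball: the principal
  value of the former is an absolutely convergent integral of the latter.\<close>

definition regularized :: "('a::euclidean_space \<Rightarrow> real) \<Rightarrow> 'a \<Rightarrow> 'a \<Rightarrow> real \<Rightarrow> 'a \<Rightarrow> real" where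
  "regularized u z p R y = u y - u z - indicator (ball z R) y * (p \<bullet> (y - z))"

context singular_kernel
begin

lemma integrable_weight:
  assumes u: "integrable lebesgue (\<lambda>x. \<bar>u x\<bar> / (1 + norm x powr q))"
    and [measurable]: "u \<in> borel_measurable lebesgue" and "0 < r"
  shows "integrable lebesgue (\<lambda>y. indicator (- ball z r) y * (u y * K (y - z)))"
proof -
  \<comment> \<open>Adds the constants of two comparisons valid for |y - z| \<ge> r: 1 \<le> r^(-q)
    |y - z|^q and |y|^q \<le> (1 + |z|/r)^q |y - z|^q.\<close>
  define M where "M = \<beta> * (r powr (- q) + (1 + norm z / r) powr q)"
  have "integrable lebesgue (\<lambda>x. M * (\<bar>u x\<bar> / (1 + norm x powr q)))"
    using u by (rule integrable_mult_right)
  then show ?thesis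
  proof (rule Bochner_Integration.integrable_bound)
    have "norm (indicator (- ball z r) y * (u y * K (y - z))) \<le> norm (M * (\<bar>u y\<bar> / (1 + norm y powr q)))" for y
    proof (cases "y \<in> ball z r")
      case False
      then have d: "r \<le> norm (y - z)" by (simp add: dist_norm norm_minus_commute)
      let ?d = "norm (y - z)"
      have "0 < ?d" using d \<open>0 < r\<close> by linarith
      have "norm y \<le> ?d + norm z" using norm_triangle_ineq[of "y - z" z] by simp
      also have "\<dots> \<le> ?d * (1 + norm z / r)"
        using d \<open>0 < r\<close> mult_right_mono[of r ?d "norm z"] by (simp add: field_simps)
      finally have "norm y powr q \<le> (?d * (1 + norm z / r)) powr q"
        using order by (intro powr_mono2) auto
      also have "\<dots> = ?d powr q * (1 + norm z / r) powr q"
        using \<open>0 < r\<close> by (simp add: powr_mult)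
      finally have 1: "norm y powr q \<le> ?d powr q * (1 + norm z / r) powr q" .
      have "r powr q \<le> ?d powr q" using d order \<open>0 < r\<close> by (intro powr_mono2) auto
      then have "1 \<le> ?d powr q * r powr (- q)"
        using \<open>0 < r\<close> by (simp add: powr_minus field_simps)
      with 1 have "1 + norm y powr q \<le> ?d powr q * (r powr (- q) + (1 + norm z / r) powr q)"
        by (simp add: distrib_left)
      then have "\<beta> * ?d powr (- q) * (1 + norm y powr q)
          \<le> \<beta> * ?d powr (- q) * (?d powr q * (r powr (- q) + (1 + norm z / r) powr q))"
        using upper_nonneg by (intro mult_left_mono) auto
      also have "\<dots> = M" using \<open>0 < ?d\<close> by (simp add: M_def powr_minus)
      finally have M: "\<beta> * ?d powr (- q) * (1 + norm y powr q) \<le> M" .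
      have pos: "0 < 1 + norm y powr q" by (simp add: add_pos_nonneg)
      have "K (y - z) \<le> M / (1 + norm y powr q)"
        using order_trans[OF upper, of "y - z" "M / (1 + norm y powr q)"] M pos by (simp add: pos_le_divide_eq)
      then have "\<bar>u y\<bar> * K (y - z) \<le> \<bar>u y\<bar> * (M / (1 + norm y powr q))"
        by (intro mult_left_mono) auto
      then show ?thesis
        using False nonneg[of "y - z"] pos upper_nonneg \<open>0 < r\<close>
        by (simp add: abs_mult M_def mult_ac)
    qed simp
    then show "AE y in lebesgue. norm (indicator (- ball z r) y * (u y * K (y - z)))
        \<le> norm (M * (\<bar>u y\<bar> / (1 + norm y powr q)))" by simp
  qed measurable
qed

lemma integrable_annulus:
  assumes "0 < r"
  shows "integrable lebesgue (\<lambda>y. indicator (ball z R - ball z r) y * (p \<bullet> (y - z)) * K (y - z))"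
proof -
  have "integrable lebesgue (\<lambda>y. norm p * R * (indicator (- ball z r) y * K (y - z)))"
    using integrable_far[OF assms] by simp
  then show ?thesis
  proof (rule Bochner_Integration.integrable_bound)
    have "norm (indicator (ball z R - ball z r) y * (p \<bullet> (y - z)) * K (y - z))
        \<le> norm (norm p * R * (indicator (- ball z r) y * K (y - z)))" for y
    proof (cases "y \<in> ball z R - ball z r")
      case True
      then have "norm (y - z) \<le> R" by (simp add: dist_norm norm_minus_commute)
      then have "\<bar>p \<bullet> (y - z)\<bar> \<le> norm p * R"
        using order_trans[OF Cauchy_Schwarz_ineq2 mult_left_mono] by (metis norm_ge_zero)
      moreover have "0 \<le> R" using \<open>norm (y - z) \<le> R\<close> norm_ge_zero order_trans by blast
      ultimately show ?thesis using True nonneg[of "y - z"]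
        by (auto simp: abs_mult indicator_def intro!: mult_right_mono)
    qed simp
    then show "AE y in lebesgue. norm (indicator (ball z R - ball z r) y * (p \<bullet> (y - z)) * K (y - z))
        \<le> norm (norm p * R * (indicator (- ball z r) y * K (y - z)))" by simp
    have [measurable]: "(\<lambda>y. p \<bullet> (y - z)) \<in> borel_measurable lebesgue"
      by measurable
    show "(\<lambda>y. indicator (ball z R - ball z r) y * (p \<bullet> (y - z)) * K (y - z)) \<in> borel_measurable lebesgue"
      by measurable
  qed
qed

text \<open>The point reflection of y in z preserves the annulus and the even kernel but reverses
  the linear factor, so the integral equals its own negative.\<close>

lemma integral_annulus:
  "(LINT y|lebesgue. indicator (ball z R - ball z r) y * (p \<bullet> (y - z)) * K (y - z)) = 0"
proof -
  let ?O = "\<lambda>y. indicator (ball z R - ball z r) y * (p \<bullet> (y - z)) * K (y - z)"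
  have [measurable]: "(\<lambda>y. p \<bullet> (y - z)) \<in> borel_measurable lebesgue"
    by measurable
  have odd: "?O (2 *\<^sub>R z + - y) = - ?O y" for y
  proof -
    have *: "2 *\<^sub>R z + - y - z = - (y - z)" by (simp add: scaleR_2)
    have "dist z (2 *\<^sub>R z + - y) = dist z y"
      by (metis * dist_norm norm_minus_cancel norm_minus_commute)
    then have "indicator (ball z R - ball z r) (2 *\<^sub>R z + - y) = (indicator (ball z R - ball z r) y :: real)"
      by (simp add: indicator_def)
    then show ?thesis unfolding * by (simp add: even[of "y - z"] inner_minus_right del: minus_diff_eq)
  qed
  have "orthogonal_transformation (uminus :: 'a \<Rightarrow> 'a)"
    using orthogonal_transformation_neg[of id] orthogonal_transformation_id by (simp add: id_def)
  then have "(LINT y|lebesgue. ?O (2 *\<^sub>R z + - y)) = (LINT y|lebesgue. ?O y)"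
    by (rule integral_isometry) measurable
  then show ?thesis unfolding odd by simp
qed

lemma integrable_regularized:
  assumes u: "integrable lebesgue (\<lambda>x. \<bar>u x\<bar> / (1 + norm x powr q))"
    and [measurable]: "u \<in> borel_measurable lebesgue"
    and taylor: "0 < \<rho>" "\<And>y. y \<in> ball z \<rho> \<Longrightarrow> \<bar>u y - u z - p \<bullet> (y - z)\<bar> \<le> L * (norm (y - z))\<^sup>2"
    and "0 < R"
  shows "integrable lebesgue (\<lambda>y. regularized u z p R y * K (y - z))"
proof -
  \<comment> \<open>The Taylor bound is known in radius \<rho>, while the linear part is removed in
    radius R. Below the smaller radius the quadratic bound controls the integrand; beyond it the
    terms are integrable one by one, the linear part in the remaining annulus being the last of
    them.\<close>
  define r where "r = min \<rho> R"
  have r: "0 < r" "r \<le> \<rho>" "r \<le> R" using assms by (auto simp: r_def)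
  have [measurable]: "(\<lambda>y. p \<bullet> (y - z)) \<in> borel_measurable lebesgue"
    by measurable
  have near: "integrable lebesgue (\<lambda>y. indicator (ball z r) y * (u y - u z - p \<bullet> (y - z)) * K (y - z))"
  proof (rule Bochner_Integration.integrable_bound)
    show "integrable lebesgue (\<lambda>y. L * (indicator (ball z r) y * (norm (y - z))\<^sup>2 * K (y - z)))"
      using integrable_near[OF r(1)] by simp
    have "norm (indicator (ball z r) y * (u y - u z - p \<bullet> (y - z)) * K (y - z))
        \<le> norm (L * (indicator (ball z r) y * (norm (y - z))\<^sup>2 * K (y - z)))" for y
    proof (cases "y \<in> ball z r")
      case True
      then have "\<bar>u y - u z - p \<bullet> (y - z)\<bar> \<le> L * (norm (y - z))\<^sup>2" using taylor(2) r(2) by auto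
      also have "\<dots> \<le> \<bar>L\<bar> * (norm (y - z))\<^sup>2" by (intro mult_right_mono abs_ge_self) simp
      finally have "\<bar>u y - u z - p \<bullet> (y - z)\<bar> * K (y - z) \<le> \<bar>L\<bar> * (norm (y - z))\<^sup>2 * K (y - z)"
        using nonneg by (intro mult_right_mono)
      then show ?thesis using True nonneg[of "y - z"] by (simp add: abs_mult mult.assoc)
    qed simp
    then show "AE y in lebesgue. norm (indicator (ball z r) y * (u y - u z - p \<bullet> (y - z)) * K (y - z))
        \<le> norm (L * (indicator (ball z r) y * (norm (y - z))\<^sup>2 * K (y - z)))" by simp
  qed measurable
  have "regularized u z p R y * K (y - z) =
      indicator (ball z r) y * (u y - u z - p \<bullet> (y - z)) * K (y - z)
      + indicator (- ball z r) y * (u y * K (y - z))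
      - u z * (indicator (- ball z r) y * K (y - z))
      - indicator (ball z R - ball z r) y * (p \<bullet> (y - z)) * K (y - z)" for y
    using r by (auto simp: regularized_def indicator_def algebra_simps)
  then show ?thesis
    using near integrable_weight[OF u _ r(1)] integrable_far[OF r(1)] integrable_annulus[OF r(1)]
    by simp
qed

text \<open>For \<epsilon> < R the truncated integrals of the two integrands differ by the integral
  of the linear part over an annulus, which is 0. Dominated convergence then supplies the limit,
  which identifies the value of \<open>Lim\<close>.\<close>

lemma PV_integral_regularized:
  assumes int: "integrable lebesgue (\<lambda>y. regularized u z p R y * K (y - z))" and "0 < R"
  shows "PV_integral (\<lambda>y. (u y - u z) * K (y - z)) z = (LINT y|lebesgue. regularized u z p R y * K (y - z))"
proof -
  let ?G = "\<lambda>y. regularized u z p R y * K (y - z)"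
  have trunc: "set_lebesgue_integral lebesgue (- ball z \<epsilon>) (\<lambda>y. (u y - u z) * K (y - z))
      = (LINT y|lebesgue. indicator (- ball z \<epsilon>) y * ?G y)" if "0 < \<epsilon>" "\<epsilon> < R" for \<epsilon>
  proof -
    have "set_lebesgue_integral lebesgue (- ball z \<epsilon>) (\<lambda>y. (u y - u z) * K (y - z))
        = (LINT y|lebesgue. indicator (- ball z \<epsilon>) y * ?G y
            + indicator (ball z R - ball z \<epsilon>) y * (p \<bullet> (y - z)) * K (y - z))"
      unfolding set_lebesgue_integral_def using that
      by (intro Bochner_Integration.integral_cong) (auto simp: regularized_def indicator_def algebra_simps)
    also have "\<dots> = (LINT y|lebesgue. indicator (- ball z \<epsilon>) y * ?G y)"
      using integrable_annulus[OF that(1)] integral_annulus integrable_real_mult_indicator[OF _ int, of "- ball z \<epsilon>"]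
      by (subst Bochner_Integration.integral_add) (simp_all add: mult.commute)
    finally show ?thesis .
  qed
  have "((\<lambda>\<epsilon>. set_lebesgue_integral lebesgue (- ball z \<epsilon>) (\<lambda>y. (u y - u z) * K (y - z)))
      \<longlongrightarrow> (LINT y|lebesgue. ?G y)) (at_right 0)"
  proof (rule tendsto_at_right_sequentially[OF \<open>0 < R\<close>])
    fix S :: "nat \<Rightarrow> real"
    assume S: "\<And>n. 0 < S n" "\<And>n. S n < R" "S \<longlonglongrightarrow> 0"
    have "(\<lambda>n. LINT y|lebesgue. indicator (- ball z (S n)) y * ?G y) \<longlonglongrightarrow> (LINT y|lebesgue. ?G y)"
    proof (rule integral_dominated_convergence[where w = "\<lambda>y. norm (?G y)"])
      show "?G \<in> borel_measurable lebesgue" using int by (rule borel_measurable_integrable)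
      then show "(\<lambda>y. indicator (- ball z (S n)) y * ?G y) \<in> borel_measurable lebesgue" for n
        by (rule borel_measurable_times[OF borel_measurable_indicator, rotated]) auto
      show "integrable lebesgue (\<lambda>y. norm (?G y))" using int by (rule integrable_norm)
      show "AE y in lebesgue. norm (indicator (- ball z (S n)) y * ?G y) \<le> norm (?G y)" for n
        by (auto simp: indicator_def)
      have "(\<lambda>n. indicator (- ball z (S n)) y * ?G y) \<longlonglongrightarrow> ?G y" for y
      proof (cases "y = z")
        case False
        then have "eventually (\<lambda>n. S n < dist z y) sequentially"
          using order_tendstoD(2)[OF S(3)] by simp
        then have "eventually (\<lambda>n. indicator (- ball z (S n)) y * ?G y = ?G y) sequentially"
          by eventually_elim simp
        then show ?thesis by (rule tendsto_eventually)
      qed simp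
      then show "AE y in lebesgue. (\<lambda>n. indicator (- ball z (S n)) y * ?G y) \<longlonglongrightarrow> ?G y" by simp
    qed
    then show "(\<lambda>n. set_lebesgue_integral lebesgue (- ball z (S n)) (\<lambda>y. (u y - u z) * K (y - z)))
        \<longlonglongrightarrow> (LINT y|lebesgue. ?G y)"
      using trunc S by simp
  qed
  then show ?thesis unfolding PV_integral_def by (intro tendsto_Lim) auto
qed

end

section \<open>Antisymmetric functions on a half-space\<close>

text \<open>A linear isometry followed by a translation, the form to which the change of variables
  applies.\<close>

lemma reflect_alt: "reflect e t x = (2 * t) *\<^sub>R e + (x - (2 * (e \<bullet> x)) *\<^sub>R e)"
  by (simp add: reflect_def algebra_simps)

lemma orthogonal_transformation_reflection:
  fixes e :: "'a::euclidean_space"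
  assumes "norm e = 1"
  shows "orthogonal_transformation (\<lambda>x. x - (2 * (e \<bullet> x)) *\<^sub>R e)"
proof -
  have "e \<bullet> e = 1" using assms by (simp add: norm_eq_1)
  then show ?thesis
    by (auto simp: orthogonal_transformation_def linear_iff inner_commute algebra_simps inner_add_left inner_add_right inner_diff_left inner_diff_right)
qed

lemma inner_reflect: "norm e = 1 \<Longrightarrow> e \<bullet> reflect e t x = 2 * t - e \<bullet> x"
  by (simp add: reflect_def inner_diff_right norm_eq_1)

lemma reflect_reflect: "norm e = 1 \<Longrightarrow> reflect e t (reflect e t x) = x"
  by (simp add: reflect_def inner_diff_right norm_eq_1 algebra_simps)

lemma
  fixes e :: "'a::euclidean_space" and F :: "'a \<Rightarrow> real"
  assumes "norm e = 1"
  shows integrable_reflect: "integrable lebesgue F \<Longrightarrow> integrable lebesgue (\<lambda>x. F (reflect e t x))"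
    and integral_reflect: "F \<in> borel_measurable lebesgue
      \<Longrightarrow> (LINT x|lebesgue. F (reflect e t x)) = (LINT x|lebesgue. F x)"
  unfolding reflect_alt
  using integrable_isometry[OF orthogonal_transformation_reflection[OF assms], of F "(2 * t) *\<^sub>R e"]
    integral_isometry[OF orthogonal_transformation_reflection[OF assms], of F "(2 * t) *\<^sub>R e"]
  by simp_all

lemma AE_not_hyperplane:
  fixes e :: "'a::euclidean_space"
  assumes "e \<noteq> 0"
  shows "AE y in lebesgue. e \<bullet> y \<noteq> t"
proof -
  have "{y. e \<bullet> y = t} \<in> null_sets lebesgue"
    using assms by (simp flip: negligible_iff_null_sets add: negligible_hyperplane)
  from AE_not_in[OF this] show ?thesis by simp
qed

lemma halfspace_lebesgue [measurable]:
  fixes e :: "'a::euclidean_space"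
  shows "{y. t < e \<bullet> y} \<in> sets lebesgue" "{y. e \<bullet> y < t} \<in> sets lebesgue"
  by (simp_all add: borel_open open_halfspace_gt open_halfspace_lt)

text \<open>The contribution of the opposite half-space is moved over by the reflection, and the
  hyperplane is null. The integrability of \<open>G\<close> is the reason for regularizing the
  principal value beforehand.\<close>

lemma
  fixes e :: "'a::euclidean_space" and G :: "'a \<Rightarrow> real"
  assumes e: "norm e = 1" and G: "integrable lebesgue G"
  shows integrable_fold: "integrable lebesgue (\<lambda>y. indicator {y. t < e \<bullet> y} y * (G y + G (reflect e t y)))"
    and integral_fold: "(LINT y|lebesgue. G y)
      = (LINT y|lebesgue. indicator {y. t < e \<bullet> y} y * (G y + G (reflect e t y)))"
proof -
  let ?P = "\<lambda>y. indicator {y. t < e \<bullet> y} y * G y" and ?N = "\<lambda>y. indicator {y. e \<bullet> y < t} y * G y"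
  have P: "integrable lebesgue ?P" and N: "integrable lebesgue ?N"
    using integrable_real_mult_indicator[OF _ G] by (simp_all add: mult.commute)
  have N': "integrable lebesgue (\<lambda>y. ?N (reflect e t y))"
    using N by (rule integrable_reflect[OF e])
  have split: "indicator {y. t < e \<bullet> y} y * (G y + G (reflect e t y)) = ?P y + ?N (reflect e t y)" for y
    by (simp add: indicator_def inner_reflect[OF e])
  show "integrable lebesgue (\<lambda>y. indicator {y. t < e \<bullet> y} y * (G y + G (reflect e t y)))"
    unfolding split using P N' by simp
  have "AE y in lebesgue. e \<bullet> y \<noteq> t" using e by (intro AE_not_hyperplane) auto
  then have "AE y in lebesgue. G y = ?P y + ?N y"
    by eventually_elim (auto simp: indicator_def)
  then have "(LINT y|lebesgue. G y) = (LINT y|lebesgue. ?P y + ?N y)"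
    using G P N by (intro integral_cong_AE) auto
  also have "\<dots> = (LINT y|lebesgue. ?P y + ?N (reflect e t y))"
    using P N N' integral_reflect[OF e, of ?N t] by simp
  finally show "(LINT y|lebesgue. G y)
      = (LINT y|lebesgue. indicator {y. t < e \<bullet> y} y * (G y + G (reflect e t y)))"
    unfolding split .
qed

section \<open>Bounds for the kernel and for folded integrals\<close>

context singular_kernel
begin

text \<open>The right-hand side depends on the kernel only through \<beta> and not on z at all,
  hence is uniform over the admissible matrices.\<close>

lemma integral_far_le:
  assumes "0 < r"
  shows "(LINT y|lebesgue. indicator (- ball z r) y * K (y - z))
      \<le> \<beta> * (LINT h::'a|lebesgue. indicator (- ball 0 r) h * norm h powr (- q))"
proof -
  have int: "integrable lebesgue (\<lambda>h::'a. indicator (- ball 0 r) h * norm h powr (- q))"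
    by (rule radial_power_far[OF order(1)]) (use assms in blast)
  let ?F = "\<lambda>h::'a. \<beta> * (indicator (- ball 0 r) h * norm h powr (- q))"
  have "(LINT y|lebesgue. indicator (- ball z r) y * K (y - z)) \<le> (LINT y|lebesgue. ?F (y - z))"
  proof (rule integral_mono[OF integrable_far[OF assms]])
    show "integrable lebesgue (\<lambda>y. ?F (y - z))"
      by (rule integrable_translate[of ?F]) (use int in simp)
    show "indicator (- ball z r) y * K (y - z) \<le> ?F (y - z)" for y
      using upper by (auto simp: indicator_def dist_norm norm_minus_commute)
  qed
  also have "\<dots> = (LINT h::'a|lebesgue. ?F h)" using int by (intro integral_translate) simp
  finally show ?thesis by simp
qed

lemma integral_near_le:
  assumes "0 < r"
  shows "(LINT y|lebesgue. indicator (ball z r) y * (norm (y - z))\<^sup>2 * K (y - z))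
      \<le> \<beta> * (LINT h::'a|lebesgue. indicator (ball 0 r) h * norm h powr (- (q - 2)))"
proof -
  have "0 \<le> q - 2" "q - 2 < real DIM('a)" using order by auto
  then have int: "integrable lebesgue (\<lambda>h::'a. indicator (ball 0 r) h * norm h powr (- (q - 2)))"
    by (rule radial_power_near) (use assms in blast)
  let ?F = "\<lambda>h::'a. \<beta> * (indicator (ball 0 r) h * norm h powr (- (q - 2)))"
  have "(LINT y|lebesgue. indicator (ball z r) y * (norm (y - z))\<^sup>2 * K (y - z)) \<le> (LINT y|lebesgue. ?F (y - z))"
  proof (rule integral_mono[OF integrable_near[OF assms]])
    show "integrable lebesgue (\<lambda>y. ?F (y - z))"
      by (rule integrable_translate[of ?F]) (use int in simp)
    show "indicator (ball z r) y * (norm (y - z))\<^sup>2 * K (y - z) \<le> ?F (y - z)" for y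
      using square_upper by (auto simp: indicator_def dist_norm norm_minus_commute)
  qed
  also have "\<dots> = (LINT h::'a|lebesgue. ?F h)" using int by (intro integral_translate) simp
  finally show ?thesis by simp
qed

text \<open>Put r = e.z - t. The ball of radius r about z - 2r e lies beyond the hyperplane and
  within distance 3r of z. There the kernel is at least \<alpha> (3r)^(-q), and the volume of the
  ball contributes r^n. Integrability holds because the opposite half-space misses the ball of
  radius r about z.\<close>

lemma
  assumes e: "norm e = 1" and z: "t < e \<bullet> z"
  shows integrable_opposite: "integrable lebesgue (\<lambda>y. indicator {y. e \<bullet> y < t} y * K (y - z))"
    and integral_opposite_ge: "\<alpha> * unit_ball_vol (real DIM('a)) * 3 powr (- q) * (e \<bullet> z - t) powr (real DIM('a) - q)
      \<le> (LINT y|lebesgue. indicator {y. e \<bullet> y < t} y * K (y - z))"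
proof -
  define r where "r = e \<bullet> z - t"
  have r: "0 < r" using z by (simp add: r_def)
  show int: "integrable lebesgue (\<lambda>y. indicator {y. e \<bullet> y < t} y * K (y - z))"
  proof (rule Bochner_Integration.integrable_bound[OF integrable_far[OF r, of z]])
    have "indicator {y. e \<bullet> y < t} y \<le> (indicator (- ball z r) y :: real)" for y
    proof -
      have "e \<bullet> z - e \<bullet> y \<le> norm (z - y)"
        using norm_cauchy_schwarz[of e "z - y"] e by (simp add: inner_diff_right)
      then show ?thesis by (auto simp: indicator_def dist_norm r_def)
    qed
    then show "AE y in lebesgue. norm (indicator {y. e \<bullet> y < t} y * K (y - z))
        \<le> norm (indicator (- ball z r) y * K (y - z))"
      using nonneg by (auto simp: abs_mult intro!: mult_right_mono)
    show "(\<lambda>y. indicator {y. e \<bullet> y < t} y * K (y - z)) \<in> borel_measurable lebesgue" by measurable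
  qed
  define x where "x = z - (2 * r) *\<^sub>R e"
  have "e \<bullet> e = 1" using e by (simp add: norm_eq_1)
  have "(LINT y|lebesgue. (\<alpha> * (3 * r) powr (- q)) * indicator (ball x r) y)
      \<le> (LINT y|lebesgue. indicator {y. e \<bullet> y < t} y * K (y - z))"
  proof (rule integral_mono[OF _ int])
    show "integrable lebesgue (\<lambda>y. (\<alpha> * (3 * r) powr (- q)) * indicator (ball x r) y)"
      by (intro integrable_mult_right integrable_real_indicator) (auto simp: emeasure_ball r less_imp_le)
    fix y
    show "(\<alpha> * (3 * r) powr (- q)) * indicator (ball x r) y \<le> indicator {y. e \<bullet> y < t} y * K (y - z)"
    proof (cases "y \<in> ball x r")
      case True
      then have xy: "norm (y - x) < r" by (simp add: dist_norm norm_minus_commute)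
      have "e \<bullet> x = t - r" using \<open>e \<bullet> e = 1\<close> by (simp add: x_def inner_diff_right r_def)
      moreover have "e \<bullet> y - e \<bullet> x \<le> norm (y - x)"
        using norm_cauchy_schwarz[of e "y - x"] e by (simp add: inner_diff_right)
      ultimately have y: "e \<bullet> y < t" using xy by linarith
      have "norm (y - z) \<le> norm (y - x) + norm (x - z)" using norm_triangle_ineq[of "y - x" "x - z"] by simp
      also have "norm (x - z) = 2 * r" using r e by (simp add: x_def)
      finally have "norm (y - z) \<le> 3 * r" using xy by linarith
      moreover have "0 < norm (y - z)" using y z by auto
      ultimately have "(3 * r) powr (- q) \<le> norm (y - z) powr (- q)"
        using order by (intro powr_mono2') auto
      then have "\<alpha> * (3 * r) powr (- q) \<le> \<alpha> * norm (y - z) powr (- q)"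
        using lower_pos by (intro mult_left_mono) auto
      then show ?thesis using order_trans[OF _ lower] y True by simp
    qed (use nonneg in simp)
  qed
  also have "(LINT y|lebesgue. (\<alpha> * (3 * r) powr (- q)) * indicator (ball x r) y)
      = \<alpha> * (3 * r) powr (- q) * (unit_ball_vol (real DIM('a)) * r ^ DIM('a))"
    using r by (simp add: content_ball)
  also have "\<dots> = \<alpha> * unit_ball_vol (real DIM('a)) * 3 powr (- q) * r powr (real DIM('a) - q)"
    using r by (simp add: powr_mult powr_diff powr_minus powr_realpow field_simps)
  finally show "\<alpha> * unit_ball_vol (real DIM('a)) * 3 powr (- q) * (e \<bullet> z - t) powr (real DIM('a) - q)
      \<le> (LINT y|lebesgue. indicator {y. e \<bullet> y < t} y * K (y - z))"
    by (simp add: r_def)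
qed

text \<open>At an exact minimum the folded integrand would be at least -2 w(z) times the reflected
  kernel. Here it can fall short by the curvature \<kappa> near z, by the gap \<delta> far from z,
  and by the slope p, whose effect on \<open>ball z R\<close> is at most 2 \<delta>.\<close>

lemma almost_min_bound:
  assumes e: "norm e = 1" and z: "t < e \<bullet> z"
    and refl: "\<And>y. t < e \<bullet> y \<Longrightarrow> y \<noteq> z \<Longrightarrow> K (reflect e t y - z) \<le> K (y - z)"
    and anti: "\<And>y. t < e \<bullet> y \<Longrightarrow> w (reflect e t y) = - w y"
    and int: "integrable lebesgue (\<lambda>y. regularized w z p R y * K (y - z))"
    and R: "0 < R" "ball z R \<subseteq> {y. t < e \<bullet> y}"
    and near: "\<And>y. y \<in> ball z R \<Longrightarrow> - \<kappa> * (norm (y - z))\<^sup>2 \<le> w y - w z - p \<bullet> (y - z)"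
    and far: "\<And>y. t < e \<bullet> y \<Longrightarrow> y \<notin> ball z R \<Longrightarrow> - \<delta> \<le> w y - w z"
    and nonneg': "0 \<le> \<kappa>" "0 \<le> \<delta>" and p: "norm p * R \<le> 2 * \<delta>"
  shows "- 2 * w z * (LINT y|lebesgue. indicator {y. e \<bullet> y < t} y * K (y - z))
      - \<kappa> * (LINT y|lebesgue. indicator (ball z R) y * (norm (y - z))\<^sup>2 * K (y - z))
      - 3 * \<delta> * (LINT y|lebesgue. indicator (- ball z R) y * K (y - z))
      \<le> PV_integral (\<lambda>y. (w y - w z) * K (y - z)) z"
proof -
  let ?H = "{y. t < e \<bullet> y}"
  let ?G = "\<lambda>y. regularized w z p R y * K (y - z)"
  let ?n = "\<lambda>y. indicator (ball z R) y * (norm (y - z))\<^sup>2 * K (y - z)"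
  let ?f = "\<lambda>y. indicator (- ball z R) y * K (y - z)"
  let ?o = "\<lambda>y. indicator {y. e \<bullet> y < t} y * K (y - z)"
  have io: "integrable lebesgue ?o" by (rule integrable_opposite[OF e z])
  then have io': "integrable lebesgue (\<lambda>y. ?o (reflect e t y))" by (rule integrable_reflect[OF e])
  have in_ball: "e \<bullet> y < t \<Longrightarrow> y \<notin> ball z R" for y using R(2) by force
  have "PV_integral (\<lambda>y. (w y - w z) * K (y - z)) z = (LINT y|lebesgue. ?G y)"
    by (rule PV_integral_regularized[OF int R(1)])
  also have "\<dots> = (LINT y|lebesgue. indicator ?H y * (?G y + ?G (reflect e t y)))"
    by (rule integral_fold[OF e int])
  also have "\<dots> \<ge> (LINT y|lebesgue. (- 2 * w z - 2 * \<delta>) * ?o (reflect e t y) - \<kappa> * ?n y - \<delta> * ?f y)"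
  proof (rule integral_mono)
    show "integrable lebesgue (\<lambda>y. (- 2 * w z - 2 * \<delta>) * ?o (reflect e t y) - \<kappa> * ?n y - \<delta> * ?f y)"
      by (intro Bochner_Integration.integrable_diff integrable_mult_right io' integrable_near integrable_far R)
    show "integrable lebesgue (\<lambda>y. indicator ?H y * (?G y + ?G (reflect e t y)))"
      by (rule integrable_fold[OF e int])
    fix y
    show "(- 2 * w z - 2 * \<delta>) * ?o (reflect e t y) - \<kappa> * ?n y - \<delta> * ?f y
        \<le> indicator ?H y * (?G y + ?G (reflect e t y))"
    proof (cases "y \<in> ?H")
      case False
      then have o: "?o (reflect e t y) = 0" by (simp add: inner_reflect[OF e])
      have "0 \<le> \<kappa> * ?n y" "0 \<le> \<delta> * ?f y" using nonneg' nonneg by simp_all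
      then show ?thesis unfolding o using False by simp
    next
      case True
      define k k' where "k = K (y - z)" and "k' = K (reflect e t y - z)"
      define i :: real where "i = indicator (ball z R) y"
      define b where "b = \<kappa> * (i * (norm (y - z))\<^sup>2) + \<delta> * (1 - i)"
      have k: "0 \<le> k'" "y \<noteq> z \<Longrightarrow> k' \<le> k" using refl True nonneg by (auto simp: k_def k'_def)
      have i: "i = 0 \<or> i = 1" by (simp add: i_def indicator_def)
      have out: "e \<bullet> reflect e t y < t" using True by (simp add: inner_reflect[OF e])
      have Gr: "?G (reflect e t y) = (- w y - w z) * k'"
        using in_ball[OF out] anti True by (simp add: regularized_def k'_def)
      have reg: "- b \<le> regularized w z p R y"
        using near[of y] far[of y] True by (cases "y \<in> ball z R") (auto simp: regularized_def b_def i_def)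
      have b: "0 \<le> b" using nonneg' i by (auto simp: b_def)
      have pb: "i * (p \<bullet> (y - z)) \<le> 2 * \<delta>"
      proof (cases "y \<in> ball z R")
        case True
        have "p \<bullet> (y - z) \<le> norm p * norm (y - z)" by (rule norm_cauchy_schwarz)
        also have "\<dots> \<le> norm p * R"
          using True by (intro mult_left_mono) (auto simp: dist_norm norm_minus_commute)
        finally show ?thesis using True p by (simp add: i_def)
      qed (use nonneg' in \<open>simp add: i_def\<close>)
      \<comment> \<open>The folded integrand is regrouped around \<open>k - k'\<close>, which is
        nonnegative for y different from z. Antisymmetry cancels \<open>w y\<close> in the
        coefficient of \<open>k'\<close>, leaving -2 w(z) and the slope term.\<close>
      have "(- 2 * w z - 2 * \<delta>) * k' - b * k \<le> regularized w z p R y * (k - k') + (- 2 * w z - i * (p \<bullet> (y - z))) * k'"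
      proof -
        have "- b * k \<le> regularized w z p R y * (k - k')"
        proof (cases "y = z")
          case False
          then have "- b * (k - k') \<le> regularized w z p R y * (k - k')"
            using reg k by (intro mult_right_mono) auto
          moreover have "0 \<le> b * k'" using b k by simp
          ultimately show ?thesis by (simp add: algebra_simps)
        qed (simp add: regularized_def k_def)
        moreover have "(- 2 * w z - 2 * \<delta>) * k' \<le> (- 2 * w z - i * (p \<bullet> (y - z))) * k'"
          using pb k by (intro mult_right_mono) auto
        ultimately show ?thesis by (simp add: algebra_simps)
      qed
      also have "\<dots> = ?G y + ?G (reflect e t y)"
        unfolding Gr by (simp add: regularized_def k_def i_def algebra_simps)
      finally have "(- 2 * w z - 2 * \<delta>) * k' - b * k \<le> ?G y + ?G (reflect e t y)" .
      moreover have "b * k = \<kappa> * ?n y + \<delta> * ?f y"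
        using i by (auto simp: b_def k_def i_def indicator_def)
      moreover have "?o (reflect e t y) = k'" using out by (simp add: k'_def)
      ultimately show ?thesis using True by simp
    qed
  qed
  also have "(LINT y|lebesgue. (- 2 * w z - 2 * \<delta>) * ?o (reflect e t y) - \<kappa> * ?n y - \<delta> * ?f y)
      = (- 2 * w z - 2 * \<delta>) * (LINT y|lebesgue. ?o y) - \<kappa> * (LINT y|lebesgue. ?n y) - \<delta> * (LINT y|lebesgue. ?f y)"
  proof -
    have "(LINT y|lebesgue. ?o (reflect e t y)) = (LINT y|lebesgue. ?o y)"
      using io by (intro integral_reflect[OF e]) auto
    then show ?thesis
      using integrable_near[OF R(1), of z] integrable_far[OF R(1), of z] io' by simp
  qed
  finally have "(- 2 * w z - 2 * \<delta>) * (LINT y|lebesgue. ?o y) - \<kappa> * (LINT y|lebesgue. ?n y) - \<delta> * (LINT y|lebesgue. ?f y)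
      \<le> PV_integral (\<lambda>y. (w y - w z) * K (y - z)) z" .
  \<comment> \<open>The opposite half-space lies outside \<open>ball z R\<close>, so the slope error
    2 \<delta> joins the far error \<delta> to give 3 \<delta>.\<close>
  moreover have "(LINT y|lebesgue. ?o y) \<le> (LINT y|lebesgue. ?f y)"
    using in_ball nonneg
    by (intro integral_mono io integrable_far R) (auto simp: indicator_def)
  then have "\<delta> * (LINT y|lebesgue. ?o y) \<le> \<delta> * (LINT y|lebesgue. ?f y)"
    using nonneg' by (intro mult_left_mono)
  ultimately show ?thesis by (simp add: algebra_simps)
qed

text \<open>With \<open>w z = 0\<close> and slope 0 the folded integrand is w(y) times the
  difference of the kernel at y - z and at the reflected point. The minorant \<open>k\<close> is a
  separate parameter so that a single weight can serve all kernels at once.\<close>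

lemma zero_min_bound:
  assumes e: "norm e = 1" and z: "t < e \<bullet> z" "w z = 0"
    and anti: "\<And>y. t < e \<bullet> y \<Longrightarrow> w (reflect e t y) = - w y"
    and int: "integrable lebesgue (\<lambda>y. regularized w z 0 R y * K (y - z))" and "0 < R"
    and w: "\<And>y. t < e \<bullet> y \<Longrightarrow> 0 \<le> w y" "w \<in> borel_measurable lebesgue"
    and k: "k \<in> borel_measurable lebesgue"
      "\<And>y. t < e \<bullet> y \<Longrightarrow> y \<noteq> z \<Longrightarrow> 0 \<le> k y \<and> k y \<le> K (y - z) - K (reflect e t y - z)"
  shows "integrable lebesgue (\<lambda>y. indicator {y. t < e \<bullet> y} y * (w y * k y))"
    and "(LINT y|lebesgue. indicator {y. t < e \<bullet> y} y * (w y * k y))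
      \<le> PV_integral (\<lambda>y. (w y - w z) * K (y - z)) z"
proof -
  let ?H = "{y. t < e \<bullet> y}"
  let ?G = "\<lambda>y. regularized w z 0 R y * K (y - z)"
  have ptw: "0 \<le> indicator ?H y * (w y * k y)
      \<and> indicator ?H y * (w y * k y) \<le> indicator ?H y * (?G y + ?G (reflect e t y))" for y
  proof (cases "y \<in> ?H \<and> y \<noteq> z")
    case True
    then have "w y * k y \<le> w y * (K (y - z) - K (reflect e t y - z))"
      using k(2) w(1) by (intro mult_left_mono) auto
    then show ?thesis using True k(2) w(1) anti z(2) by (simp add: regularized_def algebra_simps)
  next
    case False
    then show ?thesis using z anti by (auto simp: indicator_def regularized_def)
  qed
  have fold: "integrable lebesgue (\<lambda>y. indicator ?H y * (?G y + ?G (reflect e t y)))"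
    by (rule integrable_fold[OF e int])
  then show int': "integrable lebesgue (\<lambda>y. indicator ?H y * (w y * k y))"
  proof (rule Bochner_Integration.integrable_bound)
    show "AE y in lebesgue. norm (indicator ?H y * (w y * k y))
        \<le> norm (indicator ?H y * (?G y + ?G (reflect e t y)))"
    proof (rule AE_I2)
      show "norm (indicator ?H y * (w y * k y)) \<le> norm (indicator ?H y * (?G y + ?G (reflect e t y)))" for y
        using ptw[of y] unfolding real_norm_def by linarith
    qed
    show "(\<lambda>y. indicator ?H y * (w y * k y)) \<in> borel_measurable lebesgue"
      using w(2) k(1) by measurable
  qed
  have "PV_integral (\<lambda>y. (w y - w z) * K (y - z)) z = (LINT y|lebesgue. ?G y)"
    by (rule PV_integral_regularized[OF int \<open>0 < R\<close>])
  also have "\<dots> = (LINT y|lebesgue. indicator ?H y * (?G y + ?G (reflect e t y)))"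
    by (rule integral_fold[OF e int])
  finally show "(LINT y|lebesgue. indicator ?H y * (w y * k y))
      \<le> PV_integral (\<lambda>y. (w y - w z) * K (y - z)) z"
    using integral_mono[OF int' fold] ptw by simp
qed

end

section \<open>The kernels of the operator\<close>

text \<open>Since |h|/\<Theta> \<le> |A^{-1}h| \<le> |h|/\<theta>, the same two constants work for
  every admissible matrix, and the lower one involves \<theta> but not \<Theta>.\<close>

lemma admissible_kernel:
  fixes e :: "real^'n"
  assumes A: "A \<in> admissible_matrices \<theta> \<Theta> e" and \<theta>: "0 < \<theta>" "\<theta> \<le> \<Theta>" and e: "norm e = 1"
    and s: "0 < s" "s < 1" and n: "2 \<le> CARD('n)"
  defines "q \<equiv> real CARD('n) + 2 * s"
  shows "singular_kernel (\<lambda>h. norm (matrix_inv A *v h) powr (- q)) q (\<theta> powr q) (\<Theta> powr q)"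
proof
  let ?B = "matrix_inv A"
  obtain \<mu> where B: "\<And>h. norm (?B *v h) \<le> norm h / \<theta>" "\<And>h. norm h \<le> \<Theta> * norm (?B *v h)"
    using admissible_inverse[OF A \<theta>(1) e] by metis
  have q: "0 < q" using s by (simp add: q_def)
  have "continuous_on UNIV (\<lambda>h. ?B *v h)"
    by (rule linear_continuous_on) (simp add: linear_linear)
  then have [measurable]: "(\<lambda>h. ?B *v h) \<in> borel_measurable borel"
    by (rule borel_measurable_continuous_onI)
  show "(\<lambda>h. norm (?B *v h) powr (- q)) \<in> borel_measurable borel" by measurable
  fix h :: "real^'n"
  show "norm (?B *v (- h)) powr (- q) = norm (?B *v h) powr (- q)"
    using matrix_vector_mult_scaleR[of ?B "-1" h] by simp
  show "\<theta> powr q * norm h powr (- q) \<le> norm (?B *v h) powr (- q)"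
  proof (cases "h = 0")
    case False
    then have pos: "0 < norm (?B *v h)" using B(2)[of h] \<theta> by (auto simp: zero_less_mult_iff)
    have "(norm h / \<theta>) powr (- q) \<le> norm (?B *v h) powr (- q)"
      using B(1)[of h] q pos by (intro powr_mono2') auto
    then show ?thesis using \<theta> by (simp add: powr_divide powr_minus field_simps)
  qed simp
  show "norm (?B *v h) powr (- q) \<le> \<Theta> powr q * norm h powr (- q)"
  proof (cases "h = 0")
    case False
    have "norm h / \<Theta> \<le> norm (?B *v h)" using B(2)[of h] \<theta> by (simp add: field_simps)
    then have "norm (?B *v h) powr (- q) \<le> (norm h / \<Theta>) powr (- q)"
      using False q \<theta> by (intro powr_mono2') auto
    then show ?thesis using \<theta> by (simp add: powr_divide powr_minus field_simps)
  qed simp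
qed (use s n \<theta> in \<open>auto simp: q_def\<close>)

text \<open>The second bound does not depend on \<open>A\<close>, hence it survives the infimum over \<open>A\<close>.\<close>

lemma admissible_kernel_reflect:
  fixes e y z :: "real^'n"
  assumes A: "A \<in> admissible_matrices \<theta> \<Theta> e" and \<theta>: "0 < \<theta>" "\<theta> \<le> \<Theta>" and e: "norm e = 1"
    and q: "0 < q" and yz: "t < e \<bullet> y" "t < e \<bullet> z" "y \<noteq> z"
  defines "K \<equiv> \<lambda>h. norm (matrix_inv A *v h) powr (- q)"
    and "M \<equiv> (norm (reflect e t y - z) / \<theta>)\<^sup>2" and "D \<equiv> 4 * ((e \<bullet> y - t) * (e \<bullet> z - t)) / \<Theta>\<^sup>2"
  shows "K (reflect e t y - z) \<le> K (y - z)"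
    and "M powr (- (q / 2)) * ((1 + D / M) powr (q / 2) - 1) \<le> K (y - z) - K (reflect e t y - z)"
proof -
  let ?B = "matrix_inv A"
  obtain \<mu> where \<mu>: "\<theta> \<le> \<mu>" "\<mu> \<le> \<Theta>"
    and B: "\<And>h. norm (?B *v h) \<le> norm h / \<theta>" "\<And>h. norm h \<le> \<Theta> * norm (?B *v h)"
    and Brefl: "\<And>h \<beta>. (norm (?B *v (h - (2 * \<beta>) *\<^sub>R e)))\<^sup>2 = (norm (?B *v h))\<^sup>2 + 4 * (\<beta> * (\<beta> - e \<bullet> h)) / \<mu>\<^sup>2"
    using admissible_inverse[OF A \<theta>(1) e] by metis
  define a where "a = (norm (?B *v (y - z)))\<^sup>2"
  define a' where "a' = (norm (?B *v (reflect e t y - z)))\<^sup>2"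
  define P where "P = (e \<bullet> y - t) * (e \<bullet> z - t)"
  have P: "0 < P" using yz by (simp add: P_def)
  have "0 < norm (?B *v (y - z))" using B(2)[of "y - z"] yz(3) \<theta> by (auto simp: zero_less_mult_iff)
  then have a: "0 < a" by (simp add: a_def)
  have diff: "reflect e t y - z = (y - z) - (2 * (e \<bullet> y - t)) *\<^sub>R e" by (simp add: reflect_def)
  have a'_eq: "a' = a + 4 * P / \<mu>\<^sup>2"
    using Brefl[of "y - z" "e \<bullet> y - t", folded diff] by (simp add: a_def a'_def P_def inner_diff_right)
  have "4 * P / \<Theta>\<^sup>2 \<le> 4 * P / \<mu>\<^sup>2"
    using P \<mu> \<theta> by (intro divide_left_mono power_mono) auto
  then have D: "0 < D" "a + D \<le> a'" using P \<theta> by (auto simp: D_def a'_eq P_def)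
  have a': "0 < a'" "a \<le> a'" using a D by auto
  have M: "a' \<le> M" unfolding a'_def M_def by (intro power_mono B) simp
  have K: "K h = ((norm (?B *v h))\<^sup>2) powr (- (q / 2))" for h
    by (simp add: K_def powr_powr flip: powr_numeral)
  have Ka: "K (y - z) = a powr (- (q / 2))" "K (reflect e t y - z) = a' powr (- (q / 2))"
    by (simp_all add: K a_def a'_def)
  show "K (reflect e t y - z) \<le> K (y - z)"
    unfolding Ka using a a' q by (intro powr_mono2') auto
  \<comment> \<open>The difference of the kernel values factors as a'^(-q/2) ((a'/a)^(q/2) - 1). The
    bounds a' \<le> M and a + D \<le> a' make both factors at least their counterparts in M and D,
    which are free of \<open>A\<close>.\<close>
  have "1 + D / M \<le> 1 + D / a" using M a a' D by (simp add: divide_left_mono)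
  also have "\<dots> = (a + D) / a" using a by (simp add: add_divide_distrib)
  also have "\<dots> \<le> a' / a" using D a by (intro divide_right_mono) auto
  finally have "1 + D / M \<le> a' / a" .
  then have "(1 + D / M) powr (q / 2) \<le> (a' / a) powr (q / 2)"
    using D a' M q by (intro powr_mono2) (auto intro!: add_nonneg_nonneg divide_nonneg_nonneg)
  moreover have "M powr (- (q / 2)) \<le> a' powr (- (q / 2))"
    using a' M q by (intro powr_mono2') auto
  moreover have "1 \<le> (1 + D / M) powr (q / 2)"
    using D a' M q by (intro ge_one_powr_ge_zero) (auto intro!: divide_nonneg_nonneg)
  ultimately have "M powr (- (q / 2)) * ((1 + D / M) powr (q / 2) - 1)
      \<le> a' powr (- (q / 2)) * ((a' / a) powr (q / 2) - 1)"
    by (intro mult_mono) auto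
  also have "\<dots> = a powr (- (q / 2)) - a' powr (- (q / 2))"
    using a a' by (simp add: powr_divide powr_minus field_simps)
  finally show "M powr (- (q / 2)) * ((1 + D / M) powr (q / 2) - 1) \<le> K (y - z) - K (reflect e t y - z)"
    unfolding Ka .
qed

section \<open>Second-order remainder and first-order conditions\<close>

lemma C11_loc_taylor:
  assumes "w \<in> C11_loc \<Omega>" "open \<Omega>" "z \<in> \<Omega>"
  obtains p \<rho> L where "GDERIV w z :> p" "0 < \<rho>"
    "\<And>y. y \<in> ball z \<rho> \<Longrightarrow> \<bar>w y - w z - p \<bullet> (y - z)\<bar> \<le> L * (norm (y - z))\<^sup>2"
proof -
  obtain g where g: "\<And>x. x \<in> \<Omega> \<Longrightarrow> GDERIV w x :> g x"
    and "\<exists>r>0. \<exists>L. L-lipschitz_on (ball z r \<inter> \<Omega>) g"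
    using assms unfolding C11_loc_def by blast
  then obtain r L where r: "0 < r" and L: "L-lipschitz_on (ball z r \<inter> \<Omega>) g" by blast
  obtain r' where r': "0 < r'" "ball z r' \<subseteq> \<Omega>" using assms(2,3) open_contains_ball by blast
  define \<rho> where "\<rho> = min r r'"
  have sub: "ball z \<rho> \<subseteq> ball z r \<inter> \<Omega>" using r' by (auto simp: \<rho>_def)
  show ?thesis
  proof (rule that[of "g z" \<rho> L])
    show "GDERIV w z :> g z" "0 < \<rho>" using g assms(3) r r' by (auto simp: \<rho>_def)
    fix y assume y: "y \<in> ball z \<rho>"
    have "z \<in> ball z \<rho>" using y by (metis centre_in_ball ball_eq_empty empty_iff not_less)
    then have seg: "closed_segment z y \<subseteq> ball z \<rho>"
      using y by (simp add: closed_segment_subset)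
    \<comment> \<open>Mean value inequality on the segment, along which the gradient deviates from
      \<open>g z\<close> by at most \<open>L * norm (y - z)\<close>.\<close>
    have "norm (w y - w z - (\<lambda>h. h \<bullet> g z) (y - z)) \<le> norm (y - z) * (L * norm (y - z))"
    proof (rule differentiable_bound_linearization[where S = "closed_segment z y" and f' = "\<lambda>x h. h \<bullet> g x"])
      show "z + t *\<^sub>R (y - z) \<in> closed_segment z y" if "t \<in> {0..1}" for t
        using that by (auto simp: in_segment algebra_simps)
      show "(w has_derivative (\<lambda>h. h \<bullet> g x)) (at x within closed_segment z y)"
        if "x \<in> closed_segment z y" for x
      proof -
        have "x \<in> \<Omega>" using that seg sub by blast
        then show ?thesis using g by (auto simp: gderiv_def intro: has_derivative_at_withinI)
      qed
      show "onorm ((\<lambda>h. h \<bullet> g x) - (\<lambda>h. h \<bullet> g z)) \<le> L * norm (y - z)" if "x \<in> closed_segment z y" for x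
      proof (rule onorm_bound)
        have L0: "0 \<le> L" using L by (rule lipschitz_on_nonneg)
        show "0 \<le> L * norm (y - z)" using L0 by simp
        have "dist (g x) (g z) \<le> L * dist x z"
          by (rule lipschitz_onD[OF L]) (use that seg sub \<open>z \<in> ball z \<rho>\<close> in blast)+
        also have "\<dots> \<le> L * norm (y - z)"
          using that L0 by (intro mult_left_mono) (auto simp: dist_norm segment_bound)
        finally have gx: "norm (g x - g z) \<le> L * norm (y - z)" by (simp add: dist_norm)
        fix h
        have "norm (((\<lambda>h. h \<bullet> g x) - (\<lambda>h. h \<bullet> g z)) h) = \<bar>h \<bullet> (g x - g z)\<bar>"
          by (simp add: inner_diff_right)
        also have "\<dots> \<le> norm h * norm (g x - g z)" by (rule Cauchy_Schwarz_ineq2)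
        also have "\<dots> \<le> norm h * (L * norm (y - z))" using gx by (intro mult_left_mono) auto
        finally show "norm (((\<lambda>h. h \<bullet> g x) - (\<lambda>h. h \<bullet> g z)) h) \<le> L * norm (y - z) * norm h"
          by (simp add: mult_ac)
      qed
    qed auto
    then show "\<bar>w y - w z - g z \<bullet> (y - z)\<bar> \<le> L * (norm (y - z))\<^sup>2"
      by (simp add: inner_commute power2_eq_square mult_ac)
  qed
qed

lemma GDERIV_paraboloid:
  fixes a :: "'a::real_inner"
  shows "GDERIV (\<lambda>y. k * (norm (y - a))\<^sup>2) z :> (2 * k) *\<^sub>R (z - a)"
  unfolding gderiv_def power2_norm_eq_inner
  by (rule has_derivative_eq_rhs, (rule derivative_intros)+) (auto simp: inner_commute algebra_simps)

lemma GDERIV_local_min: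
  assumes "GDERIV f x :> p" "eventually (\<lambda>y. f x \<le> f y) (at x)"
  shows "p = 0"
proof -
  have "(\<lambda>h. h \<bullet> p) = (\<lambda>h. 0)"
    using has_derivative_local_min assms unfolding gderiv_def by blast
  then have "p \<bullet> p = 0" by meson
  then show ?thesis by simp
qed

section \<open>Maximum principles\<close>

text \<open>The passage from bounds uniform in the matrix to the operator. Division by a power
  becomes multiplication by the kernel, as in \<open>singular_kernel\<close>.\<close>

lemma F_op_ge:
  fixes e :: "real^'n"
  assumes "\<theta> \<le> \<Theta>" "norm e = 1"
    and "\<And>A. A \<in> admissible_matrices \<theta> \<Theta> e \<Longrightarrow>
      l \<le> PV_integral (\<lambda>y. (u y - u x) * norm (matrix_inv A *v (y - x)) powr (- (real CARD('n) + 2 * s))) x"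
  shows "l \<le> F_op s \<theta> \<Theta> e u x"
  unfolding F_op_def
proof (rule cINF_greatest)
  show "admissible_matrices \<theta> \<Theta> e \<noteq> {}" using scaled_identity_admissible[OF assms(1,2)] by blast
qed (use assms(3) in \<open>simp only: powr_minus divide_inverse\<close>)

text \<open>Far out, either \<Omega> has no points or the liminf condition keeps w above the
  arbitrary level -1; the rest of the closure is compact, so w attains a minimum on it. This makes
  the infimum of w over \<Omega> a genuine real number.\<close>

lemma bounded_below_on:
  fixes w :: "'a::euclidean_space \<Rightarrow> real"
  assumes lsc: "lsc_on (closure \<Omega>) w"
    and inf: "\<not> bounded \<Omega> \<Longrightarrow> 0 \<le> Liminf at_infinity (\<lambda>x. ereal (w x))"
  obtains M where "\<And>x. x \<in> \<Omega> \<Longrightarrow> M \<le> w x"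
proof -
  obtain b where b: "\<And>x. x \<in> \<Omega> \<Longrightarrow> b \<le> norm x \<Longrightarrow> -1 \<le> w x"
  proof (cases "bounded \<Omega>")
    case True
    then obtain b where "\<And>x. x \<in> \<Omega> \<Longrightarrow> norm x < b" using bounded_pos_less by metis
    then show ?thesis using that[of b] by fastforce
  next
    case False
    have "ereal (-1) < Liminf at_infinity (\<lambda>x. ereal (w x))"
      by (rule less_le_trans[OF _ inf[OF False]]) simp
    then have "eventually (\<lambda>x. ereal (-1) < ereal (w x)) at_infinity" by (rule less_LiminfD)
    then show ?thesis using that by (force simp: eventually_at_infinity)
  qed
  define S where "S = closure \<Omega> \<inter> cball 0 b"
  show ?thesis
  proof (cases "S = {}")
    case True
    have "-1 \<le> w x" if "x \<in> \<Omega>" for x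
      using b[OF that] that True closure_subset[of \<Omega>] by (fastforce simp: S_def)
    then show ?thesis using that by blast
  next
    case False
    have "compact S" unfolding S_def by (simp add: closed_Int_compact)
    moreover have "lsc_on S w" using lsc by (rule lsc_on_subset) (simp add: S_def)
    ultimately obtain z where z: "\<And>y. y \<in> S \<Longrightarrow> w z \<le> w y"
      using lsc_on_attains_min False by metis
    have "min (-1) (w z) \<le> w x" if "x \<in> \<Omega>" for x
    proof (cases "b \<le> norm x")
      case False
      then have "x \<in> S" using that closure_subset[of \<Omega>] by (auto simp: S_def)
      then show ?thesis using z by force
    qed (use b[OF that] in auto)
    then show ?thesis using that by blast
  qed
qed

lemma Ls_space_integrable:
  fixes w :: "real^'n \<Rightarrow> real"
  assumes "w \<in> Ls_space s"
  shows "w \<in> borel_measurable lebesgue"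
    "integrable lebesgue (\<lambda>x. \<bar>w x\<bar> / (1 + norm x powr (real CARD('n) + 2 * s)))"
  using assms by (simp_all add: Ls_space_def)

text \<open>The infimum of \<open>w\<close> need not be attained in \<open>\<Omega>\<close>: lower semicontinuity up to the hyperplane says
  nothing there, as \<open>w\<close> is unconstrained on this null set. Adding a small paraboloid centred at an
  almost minimum \<open>x\<^sub>1\<close>, on a ball whose radius is comparable to the distance from \<open>x\<^sub>1\<close> to the hyperplane,
  yields a point \<open>z\<close> where the operator is as large as at a true minimum, up to errors with the same scaling.\<close>

lemma narrow_region_nonneg:
  fixes e :: "real^'n" and w :: "real^'n \<Rightarrow> real"
  assumes n: "2 \<le> CARD('n)" and s: "0 < s" "s < 1" and \<theta>: "0 < \<theta>" "\<theta> \<le> \<Theta>" and e: "norm e = 1"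
    and \<Omega>: "open \<Omega>" "\<Omega> \<subseteq> {x. t < e \<bullet> x}" "\<And>x. x \<in> \<Omega> \<Longrightarrow> e \<bullet> x - t \<le> d"
    and inf: "\<not> bounded \<Omega> \<Longrightarrow> 0 \<le> Liminf at_infinity (\<lambda>x. ereal (w x))"
    and w: "w \<in> Ls_space s" "w \<in> C11_loc \<Omega>" "lsc_on (closure \<Omega>) w"
    and outside: "\<And>x. t < e \<bullet> x \<Longrightarrow> x \<notin> \<Omega> \<Longrightarrow> 0 \<le> w x"
    and anti: "\<And>x. t < e \<bullet> x \<Longrightarrow> w (reflect e t x) = - w x"
    and super: "\<And>x. x \<in> \<Omega> \<Longrightarrow> w x < 0 \<Longrightarrow> F_op s \<theta> \<Theta> e w x \<le> N * - w x"
    and narrow: "d powr (2 * s) * N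
      < \<theta> powr (real CARD('n) + 2 * s) * unit_ball_vol (real CARD('n)) * 3 powr (- (real CARD('n) + 2 * s))"
    and x: "x \<in> \<Omega>"
  shows "0 \<le> w x"
proof (rule ccontr)
  assume neg: "\<not> 0 \<le> w x"
  define q where "q = real CARD('n) + 2 * s"
  define C where "C = \<theta> powr q * unit_ball_vol (real CARD('n)) * 3 powr (- q)"
  have C: "0 < C" using \<theta> by (simp add: C_def)
  have "real DIM(real^'n) < q" using s by (simp add: q_def)
  then obtain c1 where c1: "0 \<le> c1"
    "\<And>\<rho>. 0 < \<rho> \<Longrightarrow> (LINT h::real^'n|lebesgue. indicator (- ball 0 \<rho>) h * norm h powr (- q))
        \<le> c1 * \<rho> powr (- (2 * s))"
    by (rule radial_power_far) (simp add: q_def)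
  have "0 \<le> q - 2" "q - 2 < real DIM(real^'n)" using s n by (simp_all add: q_def)
  then obtain c2 where c2: "0 \<le> c2"
    "\<And>\<rho>. 0 < \<rho> \<Longrightarrow> (LINT h::real^'n|lebesgue. indicator (ball 0 \<rho>) h * norm h powr (- (q - 2)))
        \<le> c2 * \<rho> powr (2 - 2 * s)"
    by (rule radial_power_near) (simp add: q_def)
  \<comment> \<open>Collects the error constants: \<open>c2\<close> from the ball,
    \<open>3 * c1\<close> from its exterior, and \<open>5 powr (2 * s)\<close> from trading R for
    the distance r of z, where r \<le> 5R. It depends on \<Theta>, but influences only the choice of
    \<delta>.\<close>
  define C' where "C' = \<Theta> powr q * (c2 + 3 * c1) * 5 powr (2 * s)"
  have C': "0 \<le> C'" using c1(1) c2(1) by (simp add: C'_def)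

  obtain M where M: "\<And>x. x \<in> \<Omega> \<Longrightarrow> M \<le> w x" using bounded_below_on[OF w(3) inf] by blast
  then have bdd: "bdd_below (w ` \<Omega>)" by (auto intro!: bdd_belowI[of _ M])
  define m where "m = - (INF x\<in>\<Omega>. w x)"
  have m_le: "- m \<le> w y" if "y \<in> \<Omega>" for y
    unfolding m_def using bdd that by (simp add: cINF_lower)
  have m: "0 < m" using m_le[OF x] neg by simp
  have m_le': "- m \<le> w y" if "t < e \<bullet> y" for y
    using m_le[of y] outside[OF that] m by (cases "y \<in> \<Omega>") auto
  \<comment> \<open>Solves 2 (m - \<delta>) C - \<delta> C' = C m: half of the doubled gain is spent
    on the almost minimality and on the errors.\<close>
  define \<delta> where "\<delta> = C * m / (2 * C + C')"
  have \<delta>: "0 < \<delta>" using C C' m by (simp add: \<delta>_def add_pos_nonneg)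
  have \<delta>_eq: "\<delta> * (2 * C + C') = C * m" using C C' by (simp add: \<delta>_def add_pos_nonneg)
  have "\<delta> * (2 * C) \<le> C * m" unfolding \<delta>_eq[symmetric] using \<delta> C' by (intro mult_left_mono) auto
  then have \<delta>m: "\<delta> < m" using C m by simp
  have "(INF x\<in>\<Omega>. w x) < - m + \<delta>" using \<delta> by (simp add: m_def)
  then obtain x1 where x1: "x1 \<in> \<Omega>" "w x1 < - m + \<delta>"
    using cINF_less_iff[OF _ bdd] x by blast
  \<comment> \<open>A quarter of the distance to the hyperplane: the ball of radius 2R about
    \<open>x1\<close> stays in the half-space, and it contains the ball of radius R about any point
    within R of \<open>x1\<close>.\<close>
  define R where "R = (e \<bullet> x1 - t) / 4"
  have R: "0 < R" using x1(1) \<Omega>(2) by (auto simp: R_def)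
  \<comment> \<open>The penalty at distance R equals the gap \<delta>, so a minimizer of the
    penalized function cannot be farther than R from \<open>x1\<close>. It also turns the near
    error, of order \<kappa> R^(2-2s), into \<delta> R^(-2s).\<close>
  define \<kappa> where "\<kappa> = \<delta> / R\<^sup>2"
  have \<kappa>: "0 < \<kappa>" "\<kappa> * R\<^sup>2 = \<delta>" using \<delta> R by (simp_all add: \<kappa>_def)
  have inner_near: "\<bar>e \<bullet> y - e \<bullet> y'\<bar> \<le> norm (y - y')" for y y'
    using Cauchy_Schwarz_ineq2[of e "y - y'"] e by (simp add: inner_diff_right)
  have cball_H: "t < e \<bullet> y" if "norm (y - x1) \<le> 2 * R" for y
    using inner_near[of y x1] that R by (simp add: R_def)

  \<comment> \<open>The closure of \<Omega> gives compactness, while the ball keeps \<open>S\<close>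
    off the hyperplane, so that the sign condition outside \<Omega> applies on the rest of
    \<open>S\<close>.\<close>
  define S where "S = closure \<Omega> \<inter> cball x1 (2 * R)"
  define \<phi> where "\<phi> y = w y + \<kappa> * (norm (y - x1))\<^sup>2" for y
  have "x1 \<in> S" using x1(1) closure_subset R by (auto simp: S_def)
  have "lsc_on S \<phi>" unfolding \<phi>_def
    by (intro lsc_on_add_continuous lsc_on_subset[OF w(3)] continuous_intros) (simp add: S_def)
  moreover have "compact S" unfolding S_def by (simp add: closed_Int_compact)
  ultimately obtain z where z: "z \<in> S" "\<And>y. y \<in> S \<Longrightarrow> \<phi> z \<le> \<phi> y"
    using lsc_on_attains_min \<open>x1 \<in> S\<close> by (metis empty_iff)
  have \<phi>z: "\<phi> z < - m + \<delta>" using z(2)[OF \<open>x1 \<in> S\<close>] x1(2) by (simp add: \<phi>_def)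
  have zH: "t < e \<bullet> z" using z(1) by (intro cball_H) (simp add: S_def dist_norm norm_minus_commute)
  have "w z \<le> \<phi> z" using \<kappa> by (simp add: \<phi>_def)
  then have wz: "w z < - m + \<delta>" "w z < 0" using \<phi>z \<delta>m by auto
  then have z\<Omega>: "z \<in> \<Omega>" using outside[OF zH] by fastforce
  have "\<kappa> * (norm (z - x1))\<^sup>2 \<le> \<kappa> * R\<^sup>2"
    using \<phi>z m_le[OF z\<Omega>] unfolding \<kappa>(2) by (simp add: \<phi>_def)
  then have zx1: "norm (z - x1) \<le> R" using \<kappa>(1) R by (simp add: power2_le_iff_abs_le)
  \<comment> \<open>Minimality over \<open>S\<close> extends to a full ball: its points outside
    \<open>S\<close> are in the half-space but not in \<Omega>, where \<phi> is nonnegative while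
    \<phi>(z) is negative.\<close>
  have \<phi>_min: "\<phi> z \<le> \<phi> y" if "y \<in> ball z R" for y
  proof (cases "y \<in> S")
    case False
    have "norm (y - x1) \<le> 2 * R"
      using norm_triangle_ineq[of "y - z" "z - x1"] that zx1 by (simp add: dist_norm norm_minus_commute)
    then have "y \<notin> \<Omega>" "t < e \<bullet> y"
      using False closure_subset[of \<Omega>] cball_H by (auto simp: S_def dist_norm norm_minus_commute)
    then have "0 \<le> w y" using outside by blast
    also have "w y \<le> \<phi> y" using \<kappa> by (simp add: \<phi>_def)
    finally show ?thesis using \<phi>z \<delta>m by linarith
  qed (rule z(2))
  obtain p \<rho> L where p: "GDERIV w z :> p" and \<rho>: "0 < \<rho>"
    and taylor: "\<And>y. y \<in> ball z \<rho> \<Longrightarrow> \<bar>w y - w z - p \<bullet> (y - z)\<bar> \<le> L * (norm (y - z))\<^sup>2"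
    using C11_loc_taylor[OF w(2) \<Omega>(1) z\<Omega>] by metis
  \<comment> \<open>First-order condition at the interior minimum z of \<phi>: the gradient of w
    cancels that of the paraboloid, so the slope is explicit and has size at most 2 \<kappa>
    R.\<close>
  have p_eq: "p = - ((2 * \<kappa>) *\<^sub>R (z - x1))"
  proof -
    have "GDERIV \<phi> z :> p + (2 * \<kappa>) *\<^sub>R (z - x1)"
      unfolding \<phi>_def by (intro GDERIV_add p GDERIV_paraboloid)
    moreover have "eventually (\<lambda>y. \<phi> z \<le> \<phi> y) (at z)"
      using \<phi>_min R by (auto simp: eventually_at dist_commute intro!: exI[of _ R])
    ultimately have "p + (2 * \<kappa>) *\<^sub>R (z - x1) = 0" by (rule GDERIV_local_min)
    then show ?thesis by (simp add: eq_neg_iff_add_eq_0)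
  qed
  have near: "- \<kappa> * (norm (y - z))\<^sup>2 \<le> w y - w z - p \<bullet> (y - z)" if "y \<in> ball z R" for y
  proof -
    have "(norm (y - x1))\<^sup>2 = (norm (y - z))\<^sup>2 + 2 * ((z - x1) \<bullet> (y - z)) + (norm (z - x1))\<^sup>2"
      unfolding power2_norm_eq_inner by (simp add: inner_diff_left inner_diff_right inner_commute)
    then have "\<kappa> * (norm (y - x1))\<^sup>2
        = \<kappa> * (norm (y - z))\<^sup>2 + 2 * \<kappa> * ((z - x1) \<bullet> (y - z)) + \<kappa> * (norm (z - x1))\<^sup>2"
      by (simp add: distrib_left)
    moreover have "p \<bullet> (y - z) = - (2 * \<kappa> * ((z - x1) \<bullet> (y - z)))" by (simp add: p_eq)
    ultimately show ?thesis using \<phi>_min[OF that] by (simp add: \<phi>_def)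
  qed
  have pR: "norm p * R \<le> 2 * \<delta>"
  proof -
    have "norm p * R = 2 * \<kappa> * (norm (z - x1) * R)" using \<kappa> by (simp add: p_eq)
    also have "\<dots> \<le> 2 * \<kappa> * (R * R)" using \<kappa> R zx1 by (intro mult_left_mono mult_right_mono) auto
    also have "\<dots> = 2 * \<delta>" unfolding \<kappa>(2)[symmetric] by (simp add: power2_eq_square)
    finally show ?thesis .
  qed
  define r where "r = e \<bullet> z - t"
  have r: "0 < r" "r \<le> 5 * R" "r \<le> d"
    using zH inner_near[of z x1] zx1 \<Omega>(3)[OF z\<Omega>] by (auto simp: r_def R_def)
  have ball_H: "ball z R \<subseteq> {y. t < e \<bullet> y}"
  proof
    fix y assume "y \<in> ball z R"
    then have "norm (y - x1) \<le> 2 * R"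
      using norm_triangle_ineq[of "y - z" "z - x1"] zx1 by (simp add: dist_norm norm_minus_commute)
    then show "y \<in> {y. t < e \<bullet> y}" using cball_H by simp
  qed
  have Rr: "R powr (- (2 * s)) \<le> 5 powr (2 * s) * r powr (- (2 * s))"
  proof -
    have "R powr (- (2 * s)) \<le> (r / 5) powr (- (2 * s))" using r s by (intro powr_mono2') auto
    then show ?thesis using r by (simp add: powr_divide powr_minus field_simps)
  qed
  have "C * m * r powr (- (2 * s)) \<le> F_op s \<theta> \<Theta> e w z"
  proof (rule F_op_ge[OF \<theta>(2) e])
    fix A assume A: "A \<in> admissible_matrices \<theta> \<Theta> e"
    define K where "K h = norm (matrix_inv A *v h) powr (- q)" for h
    interpret singular_kernel K q "\<theta> powr q" "\<Theta> powr q"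
      unfolding K_def q_def by (rule admissible_kernel[OF A \<theta> e s n])
    let ?J = "LINT y|lebesgue. indicator {y. e \<bullet> y < t} y * K (y - z)"
    let ?I = "LINT y|lebesgue. indicator (ball z R) y * (norm (y - z))\<^sup>2 * K (y - z)"
    let ?E = "LINT y|lebesgue. indicator (- ball z R) y * K (y - z)"
    have int: "integrable lebesgue (\<lambda>y. regularized w z p R y * K (y - z))"
      using integrable_regularized[OF _ _ \<rho> taylor R] Ls_space_integrable[OF w(1)] by (simp add: q_def)
    have "0 < q" using s by (simp add: q_def)
    then have "K (reflect e t y - z) \<le> K (y - z)" if "t < e \<bullet> y" "y \<noteq> z" for y
      unfolding K_def by (intro admissible_kernel_reflect(1)[OF A \<theta> e] that zH)
    moreover have "- \<delta> \<le> w y - w z" if "t < e \<bullet> y" for y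
      using m_le'[OF that] wz by linarith
    ultimately have PV: "- 2 * w z * ?J - \<kappa> * ?I - 3 * \<delta> * ?E
        \<le> PV_integral (\<lambda>y. (w y - w z) * K (y - z)) z"
      using near \<kappa> \<delta> by (intro almost_min_bound[OF e zH _ anti int R ball_H near _ _ _ pR]) auto
    have J: "C * r powr (- (2 * s)) \<le> ?J"
      using integral_opposite_ge[OF e zH] by (simp add: C_def r_def q_def)
    have "\<kappa> * ?I \<le> \<kappa> * (\<Theta> powr q * (c2 * R powr (2 - 2 * s)))"
      using \<kappa> order_trans[OF integral_near_le[OF R] mult_left_mono[OF c2(2)[OF R]]]
      by (intro mult_left_mono) auto
    also have "\<dots> = \<delta> * (\<Theta> powr q * (c2 * R powr (- (2 * s))))"
      unfolding \<kappa>(2)[symmetric] using R by (simp add: powr_diff powr_minus field_simps)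
    finally have I: "\<kappa> * ?I \<le> \<delta> * (\<Theta> powr q * (c2 * R powr (- (2 * s))))" .
    have "?E \<le> \<Theta> powr q * (c1 * R powr (- (2 * s)))"
      using order_trans[OF integral_far_le[OF R] mult_left_mono[OF c1(2)[OF R]]] by simp
    then have "3 * \<delta> * ?E \<le> 3 * \<delta> * (\<Theta> powr q * (c1 * R powr (- (2 * s))))"
      using \<delta> by (intro mult_left_mono) auto
    with I have "\<kappa> * ?I + 3 * \<delta> * ?E \<le> \<delta> * (\<Theta> powr q * (c2 + 3 * c1)) * R powr (- (2 * s))"
      by (simp add: algebra_simps)
    also have "\<dots> \<le> \<delta> * (\<Theta> powr q * (c2 + 3 * c1)) * (5 powr (2 * s) * r powr (- (2 * s)))"
      using Rr \<delta> c1(1) c2(1) by (intro mult_left_mono) auto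
    also have "\<dots> = \<delta> * C' * r powr (- (2 * s))" by (simp add: C'_def)
    finally have err: "\<kappa> * ?I + 3 * \<delta> * ?E \<le> \<delta> * C' * r powr (- (2 * s))" .
    have "2 * (m - \<delta>) * (C * r powr (- (2 * s))) \<le> - 2 * w z * ?J"
      by (rule mult_mono) (use J wz C \<delta>m in auto)
    moreover have "C * m * r powr (- (2 * s)) = 2 * (m - \<delta>) * (C * r powr (- (2 * s))) - \<delta> * C' * r powr (- (2 * s))"
    proof -
      have "2 * (m - \<delta>) * (C * r powr (- (2 * s))) - \<delta> * C' * r powr (- (2 * s))
          = (2 * (C * m) - \<delta> * (2 * C + C')) * r powr (- (2 * s))"
        by (simp add: algebra_simps)
      then show ?thesis unfolding \<delta>_eq by simp
    qed
    ultimately have "C * m * r powr (- (2 * s)) \<le> PV_integral (\<lambda>y. (w y - w z) * K (y - z)) z"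
      using PV err by linarith
    then show "C * m * r powr (- (2 * s)) \<le> PV_integral
        (\<lambda>y. (w y - w z) * norm (matrix_inv A *v (y - z)) powr (- (real CARD('n) + 2 * s))) z"
      by (simp only: K_def q_def)
  qed
  also have "\<dots> \<le> N * - w z" by (rule super[OF z\<Omega> wz(2)])
  finally have le: "C * m * r powr (- (2 * s)) \<le> N * - w z" .
  have "0 < C * m * r powr (- (2 * s))" using C m r by simp
  \<comment> \<open>Positivity of N is a consequence of the inequality just obtained; it is required
    before -w(z) is replaced by m and later r by d.\<close>
  then have "0 < N" using le wz(2) by (metis less_le_trans neg_0_less_iff_less zero_less_mult_pos2)
  then have "N * - w z \<le> N * m" using m_le[OF z\<Omega>] by (intro mult_left_mono) auto
  with le have "(C * r powr (- (2 * s))) * m \<le> N * m" by (simp add: mult_ac)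
  then have "C * r powr (- (2 * s)) \<le> N" using m by simp
  then have "C \<le> r powr (2 * s) * N" using r by (simp add: powr_minus field_simps)
  also have "\<dots> \<le> d powr (2 * s) * N" using r s \<open>0 < N\<close> by (intro mult_right_mono powr_mono2) auto
  finally show False using narrow by (simp add: C_def q_def)
qed

lemma strong_maximum_principle:
  fixes e :: "real^'n" and w :: "real^'n \<Rightarrow> real"
  assumes n: "2 \<le> CARD('n)" and s: "0 < s" "s < 1" and \<theta>: "0 < \<theta>" "\<theta> \<le> \<Theta>" and e: "norm e = 1"
    and \<Omega>: "open \<Omega>" "\<Omega> \<subseteq> {x. t < e \<bullet> x}"
    and w: "w \<in> Ls_space s" "w \<in> C11_loc \<Omega>"
    and w_nonneg: "\<And>x. t < e \<bullet> x \<Longrightarrow> 0 \<le> w x"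
    and anti: "\<And>x. t < e \<bullet> x \<Longrightarrow> w (reflect e t x) = - w x"
    and z: "z \<in> \<Omega>" "w z = 0" "F_op s \<theta> \<Theta> e w z \<le> 0"
  shows "AE x in lebesgue. w x = 0"
proof -
  let ?H = "{x. t < e \<bullet> x}"
  define q where "q = real CARD('n) + 2 * s"
  have q: "0 < q" using s by (simp add: q_def)
  have zH: "t < e \<bullet> z" using z(1) \<Omega>(2) by blast
  obtain p \<rho> L where p: "GDERIV w z :> p" and \<rho>: "0 < \<rho>"
    and taylor: "\<And>y. y \<in> ball z \<rho> \<Longrightarrow> \<bar>w y - w z - p \<bullet> (y - z)\<bar> \<le> L * (norm (y - z))\<^sup>2"
    using C11_loc_taylor[OF w(2) \<Omega>(1) z(1)] by metis
  have "eventually (\<lambda>y. y \<in> \<Omega>) (at z)" using \<Omega>(1) z(1) by (rule eventually_at_in_open')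
  then have "eventually (\<lambda>y. w z \<le> w y) (at z)"
    by eventually_elim (use \<Omega>(2) w_nonneg z(2) in auto)
  \<comment> \<open>As w is nonnegative in the half-space, its zero z is a local minimum, so the
    regularization has slope 0.\<close>
  then have p0: "p = 0" by (rule GDERIV_local_min[OF p])
  \<comment> \<open>\<open>M\<close>, \<open>D\<close> and \<open>k\<close> form the lower bound of
    \<open>admissible_kernel_reflect\<close> as functions of y. Being free of the matrix,
    \<open>k\<close> is one strictly positive weight for all kernels.\<close>
  define M where "M y = (norm (reflect e t y - z) / \<theta>)\<^sup>2" for y
  define D where "D y = 4 * ((e \<bullet> y - t) * (e \<bullet> z - t)) / \<Theta>\<^sup>2" for y
  define k where "k y = M y powr (- (q / 2)) * ((1 + D y / M y) powr (q / 2) - 1)" for y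
  have D_pos: "0 < D y" if "t < e \<bullet> y" for y using that zH \<theta> by (simp add: D_def)
  have M_pos: "0 < M y" if "t < e \<bullet> y" for y
  proof -
    have "e \<bullet> reflect e t y < e \<bullet> z" using that zH by (simp add: inner_reflect[OF e])
    then have "reflect e t y \<noteq> z" by auto
    then show ?thesis using \<theta> by (simp add: M_def)
  qed
  have k_pos: "0 < k y" if "t < e \<bullet> y" for y
  proof -
    have "1 < (1 + D y / M y) powr (q / 2)"
      using D_pos[OF that] M_pos[OF that] q by (intro gr_one_powr) auto
    then show ?thesis using M_pos[OF that] by (simp add: k_def)
  qed
  have k_meas: "k \<in> borel_measurable lebesgue"
    unfolding k_def M_def D_def reflect_def by measurable
  have PV: "integrable lebesgue (\<lambda>y. indicator ?H y * (w y * k y))"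
    "(LINT y|lebesgue. indicator ?H y * (w y * k y))
      \<le> PV_integral (\<lambda>y. (w y - w z) * norm (matrix_inv A *v (y - z)) powr (- q)) z"
    if A: "A \<in> admissible_matrices \<theta> \<Theta> e" for A
  proof -
    define K where "K h = norm (matrix_inv A *v h) powr (- q)" for h
    interpret singular_kernel K q "\<theta> powr q" "\<Theta> powr q"
      unfolding K_def q_def by (rule admissible_kernel[OF A \<theta> e s n])
    have int: "integrable lebesgue (\<lambda>y. regularized w z 0 1 y * K (y - z))"
      using integrable_regularized[OF _ _ \<rho> taylor zero_less_one] Ls_space_integrable[OF w(1)]
      by (simp add: q_def p0)
    have "0 \<le> k y \<and> k y \<le> K (y - z) - K (reflect e t y - z)" if "t < e \<bullet> y" "y \<noteq> z" for y
      using k_pos[OF that(1)] admissible_kernel_reflect(2)[OF A \<theta> e q that(1) zH that(2)]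
      by (simp add: k_def M_def D_def K_def)
    note bound = zero_min_bound[OF e zH z(2) anti int zero_less_one w_nonneg Ls_space_integrable(1)[OF w(1)] k_meas this]
    show "integrable lebesgue (\<lambda>y. indicator ?H y * (w y * k y))" by (rule bound(1))
    show "(LINT y|lebesgue. indicator ?H y * (w y * k y))
      \<le> PV_integral (\<lambda>y. (w y - w z) * norm (matrix_inv A *v (y - z)) powr (- q)) z"
      using bound(2) by (simp add: K_def)
  qed
  have "(LINT y|lebesgue. indicator ?H y * (w y * k y)) \<le> F_op s \<theta> \<Theta> e w z"
    using PV(2) unfolding q_def by (rule F_op_ge[OF \<theta>(2) e])
  then have "(LINT y|lebesgue. indicator ?H y * (w y * k y)) \<le> 0" using z(3) by simp
  moreover have ptw: "0 \<le> indicator ?H y * (w y * k y)" for y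
    using w_nonneg k_pos by (simp add: indicator_def less_imp_le)
  ultimately have "(LINT y|lebesgue. indicator ?H y * (w y * k y)) = 0"
    by (intro antisym integral_nonneg_AE) auto
  \<comment> \<open>Integrability is the same assertion for every matrix, so one admissible matrix,
    the scaled identity, supplies it.\<close>
  then have "AE y in lebesgue. indicator ?H y * (w y * k y) = 0"
    using integral_nonneg_eq_0_iff_AE[OF PV(1)] scaled_identity_admissible[OF \<theta>(2) e] ptw by simp
  then have AE_H: "AE y in lebesgue. t < e \<bullet> y \<longrightarrow> w y = 0"
    by eventually_elim (use k_pos in force)
  have refl: "reflect e t = (\<lambda>x. (2 * t) *\<^sub>R e + (x - (2 * (e \<bullet> x)) *\<^sub>R e))"
    by (rule ext) (rule reflect_alt)
  note isometry = orthogonal_transformation_reflection[OF e]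
  \<comment> \<open>Invariance of the measure and antisymmetry carry the vanishing to the other
    side; the hyperplane, where antisymmetry gives no information, is null.\<close>
  have "AE y in distr lebesgue lebesgue (reflect e t). t < e \<bullet> y \<longrightarrow> w y = 0"
    unfolding refl isometry_lebesgue[OF isometry] by (rule AE_H)
  then have "AE y in lebesgue. t < e \<bullet> reflect e t y \<longrightarrow> w (reflect e t y) = 0"
    by (rule AE_distrD[rotated]) (use isometry_lebesgue_measurable[OF isometry] in \<open>simp only: refl\<close>)
  moreover have "AE y in lebesgue. e \<bullet> y \<noteq> t" using e by (intro AE_not_hyperplane) auto
  ultimately show ?thesis using AE_H
  proof eventually_elim
    case (elim y)
    show ?case
    proof (cases "t < e \<bullet> y")
      case False
      then have "t < e \<bullet> reflect e t y" using elim by (simp add: inner_reflect[OF e])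
      then show ?thesis using elim anti[of "reflect e t y"] by (simp add: reflect_reflect[OF e])
    qed (use elim in blast)
  qed
qed

text \<open>Bounds the height of \<Omega> above the first hyperplane, at most |t - \<tau>|, by the
  distance in the narrowness condition.\<close>

lemma setdist_hyperplanes_ge:
  fixes e :: "'a::euclidean_space"
  assumes "norm e = 1"
  shows "\<bar>t - \<tau>\<bar> \<le> setdist (hyperplane e t) (hyperplane e \<tau>)"
proof (rule le_setdistI)
  have "a *\<^sub>R e \<in> hyperplane e a" for a using assms by (simp add: hyperplane_def norm_eq_1)
  then show "hyperplane e t \<noteq> {}" "hyperplane e \<tau> \<noteq> {}" by auto
  fix x y assume "x \<in> hyperplane e t" "y \<in> hyperplane e \<tau>"
  then have "e \<bullet> (x - y) = t - \<tau>" by (simp add: hyperplane_def inner_diff_right)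
  then show "\<bar>t - \<tau>\<bar> \<le> dist x y"
    using Cauchy_Schwarz_ineq2[of e "x - y"] assms by (simp add: dist_norm)
qed

section \<open>Reversal of the normal vector\<close>

lemma admissible_matrices_minus:
  fixes e :: "real^'n"
  shows "admissible_matrices \<theta> \<Theta> (- e) = admissible_matrices \<theta> \<Theta> e"
proof -
  have "A *v (- e) = - (A *v e)" for A :: "real^'n^'n" using matrix_vector_mult_scaleR[of A "-1" e] by simp
  then show ?thesis by (simp add: admissible_matrices_def)
qed

lemma F_op_minus: "F_op s \<theta> \<Theta> (- e) u x = F_op s \<theta> \<Theta> e u x"
  by (simp add: F_op_def admissible_matrices_minus)

lemma reflect_minus: "reflect (- e) (- t) x = reflect e t x"
  by (simp add: reflect_def algebra_simps)

lemma hyperplane_minus: "hyperplane (- e) (- t) = hyperplane e t"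
  by (simp add: hyperplane_def)

lemma region_between_minus: "region_between (- e) (- t) (- \<tau>) = region_between e t \<tau>"
proof -
  have "- a \<in> closed_segment (- t) (- \<tau>) \<longleftrightarrow> a \<in> closed_segment t \<tau>" for a :: real
    by (auto simp: closed_segment_eq_real_ivl)
  then show ?thesis by (simp add: region_between_def)
qed

lemma half_space_case:
  fixes e :: "real^'n" and w :: "real^'n \<Rightarrow> real"
  assumes n: "2 \<le> CARD('n)" and s: "0 < s" "s < 1" and \<theta>: "0 < \<theta>" "\<theta> \<le> \<Theta>" and e: "norm e = 1"
    and \<Omega>: "open \<Omega>" "\<Omega> \<subseteq> {x. t < e \<bullet> x}" "\<Omega> \<subseteq> region_between e t \<tau>"
    and inf: "\<not> bounded \<Omega> \<Longrightarrow> 0 \<le> Liminf at_infinity (\<lambda>x. ereal (w x))"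
    and w: "w \<in> Ls_space s" "w \<in> C11_loc \<Omega>" "lsc_on (closure \<Omega>) w"
    and super: "\<And>x. x \<in> \<Omega> \<Longrightarrow> w x < 0 \<Longrightarrow> F_op s \<theta> \<Theta> e w x - c x * w x \<le> 0"
    and outside: "\<And>x. t < e \<bullet> x \<Longrightarrow> x \<notin> \<Omega> \<Longrightarrow> 0 \<le> w x"
    and anti: "\<And>x. t < e \<bullet> x \<Longrightarrow> w (reflect e t x) = - w x"
    and c: "bdd_below (c ` {x\<in>\<Omega>. w x < 0})"
    and narrow: "ereal (setdist (hyperplane e t) (hyperplane e \<tau>) powr (2 * s)) *
      (- (INF x\<in>{x\<in>\<Omega>. w x < 0}. ereal (c x)))
      < ereal (\<theta> powr (real CARD('n) + 2 * s) * unit_ball_vol (real CARD('n)) * 3 powr (- (real CARD('n) + 2 * s)))"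
  shows "(\<forall>x\<in>\<Omega>. 0 \<le> w x) \<and>
    ((\<forall>x\<in>\<Omega>. w x = 0 \<longrightarrow> F_op s \<theta> \<Theta> e w x \<le> 0) \<longrightarrow>
      (\<forall>x\<in>\<Omega>. 0 < w x) \<or> (AE x in lebesgue. w x = 0))"
proof (intro conjI impI)
  let ?S = "{x\<in>\<Omega>. w x < 0}"
  let ?d = "setdist (hyperplane e t) (hyperplane e \<tau>)"
  have d: "e \<bullet> x - t \<le> ?d" if "x \<in> \<Omega>" for x
  proof -
    have "e \<bullet> x \<in> closed_segment t \<tau>" using that \<Omega>(3) by (auto simp: region_between_def)
    then have "e \<bullet> x - t \<le> \<bar>t - \<tau>\<bar>" by (auto simp: closed_segment_eq_real_ivl split: if_splits)
    then show ?thesis using setdist_hyperplanes_ge[OF e, of t \<tau>] by simp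
  qed
  show w_nonneg: "\<forall>x\<in>\<Omega>. 0 \<le> w x"
  proof (rule ccontr)
    assume neg: "\<not> (\<forall>x\<in>\<Omega>. 0 \<le> w x)"
    then obtain x where x: "x \<in> \<Omega>" "\<not> 0 \<le> w x" by blast
    define N where "N = - Inf (c ` ?S)"
    \<comment> \<open>The negativity set contains x in this branch, so the extended infimum is an
      ordinary real and the narrowness condition can be read over the reals.\<close>
    have "(INF x\<in>?S. ereal (c x)) = ereal (Inf (c ` ?S))"
      using x by (subst ereal_Inf'[OF c]) (auto simp: image_comp)
    then have N: "?d powr (2 * s) * N
        < \<theta> powr (real CARD('n) + 2 * s) * unit_ball_vol (real CARD('n)) * 3 powr (- (real CARD('n) + 2 * s))"
      using narrow by (simp add: N_def)
    have "F_op s \<theta> \<Theta> e w x \<le> N * - w x" if "x \<in> \<Omega>" "w x < 0" for x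
    proof -
      have "- N \<le> c x" unfolding N_def using c that by (simp add: cINF_lower)
      then have "c x * w x \<le> - N * w x" using that by (intro mult_right_mono_neg) auto
      then show ?thesis using super[OF that] by simp
    qed
    from narrow_region_nonneg[OF n s \<theta> e \<Omega>(1,2) d inf w outside anti this N x(1)] x(2)
    show False by blast
  qed
  assume F0: "\<forall>x\<in>\<Omega>. w x = 0 \<longrightarrow> F_op s \<theta> \<Theta> e w x \<le> 0"
  show "(\<forall>x\<in>\<Omega>. 0 < w x) \<or> (AE x in lebesgue. w x = 0)"
  proof (cases "\<exists>z\<in>\<Omega>. w z = 0")
    case True
    then obtain z where z: "z \<in> \<Omega>" "w z = 0" by blast
    have "0 \<le> w x" if "t < e \<bullet> x" for x using w_nonneg outside[OF that] by blast
    then show ?thesis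
      using strong_maximum_principle[OF n s \<theta> e \<Omega>(1,2) w(1,2) _ anti z] F0 z by blast
  qed (use w_nonneg in \<open>force simp: order_less_le\<close>)
qed

text \<open>Choosing \<open>C\<close> before \<open>\<Theta>\<close>, \<open>e\<close>, the
  hyperplanes, \<open>\<Omega>\<close>, \<open>w\<close> and \<open>c\<close> expresses that it
  depends on n, s and \<theta> alone. With extended reals the infimum over an empty negativity set
  is infinite, so narrowness then holds automatically.\<close>

theorem theorem2p5:
  fixes s \<theta> :: real
  assumes "CARD('n::finite) \<ge> 2" and "0 < s" "s < 1" and "0 < \<theta>"
  shows "\<exists>C>0. \<forall>\<Theta> (e :: real^'n) t \<tau> H \<Omega> w c.
    \<theta> \<le> \<Theta> \<and> norm e = 1 \<and>
    (H = {x. t < e \<bullet> x} \<or> H = {x. e \<bullet> x < t}) \<and>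
    open \<Omega> \<and> \<Omega> \<subseteq> H \<and> \<Omega> \<subseteq> region_between e t \<tau> \<and>
    (\<not> bounded \<Omega> \<longrightarrow> 0 \<le> Liminf at_infinity (\<lambda>x. ereal (w x))) \<and>
    w \<in> Ls_space s \<and> w \<in> C11_loc \<Omega> \<and> lsc_on (closure \<Omega>) w \<and>
    (\<forall>x\<in>\<Omega>. w x < 0 \<longrightarrow> F_op s \<theta> \<Theta> e w x - c x * w x \<le> 0) \<and>
    (\<forall>x\<in>H - \<Omega>. 0 \<le> w x) \<and>
    (\<forall>x\<in>H. w (reflect e t x) = - w x) \<and>
    bdd_below (c ` {x\<in>\<Omega>. w x < 0}) \<and>
    ereal (setdist (hyperplane e t) (hyperplane e \<tau>) powr (2 * s)) *
      (- (INF x\<in>{x\<in>\<Omega>. w x < 0}. ereal (c x))) < ereal C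
    \<longrightarrow>
    (\<forall>x\<in>\<Omega>. 0 \<le> w x) \<and>
    ((\<forall>x\<in>\<Omega>. w x = 0 \<longrightarrow> F_op s \<theta> \<Theta> e w x \<le> 0) \<longrightarrow>
      (\<forall>x\<in>\<Omega>. 0 < w x) \<or> (AE x in lebesgue. w x = 0))"
proof -
  let ?C = "\<theta> powr (real CARD('n) + 2 * s) * unit_ball_vol (real CARD('n)) * 3 powr (- (real CARD('n) + 2 * s))"
  show ?thesis
  proof (rule exI[of _ ?C], rule conjI)
    show "0 < ?C" using assms by simp
  next
    show "\<forall>\<Theta> (e :: real^'n) t \<tau> H \<Omega> w c.
      \<theta> \<le> \<Theta> \<and> norm e = 1 \<and>
      (H = {x. t < e \<bullet> x} \<or> H = {x. e \<bullet> x < t}) \<and>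
      open \<Omega> \<and> \<Omega> \<subseteq> H \<and> \<Omega> \<subseteq> region_between e t \<tau> \<and>
      (\<not> bounded \<Omega> \<longrightarrow> 0 \<le> Liminf at_infinity (\<lambda>x. ereal (w x))) \<and>
      w \<in> Ls_space s \<and> w \<in> C11_loc \<Omega> \<and> lsc_on (closure \<Omega>) w \<and>
      (\<forall>x\<in>\<Omega>. w x < 0 \<longrightarrow> F_op s \<theta> \<Theta> e w x - c x * w x \<le> 0) \<and>
      (\<forall>x\<in>H - \<Omega>. 0 \<le> w x) \<and>
      (\<forall>x\<in>H. w (reflect e t x) = - w x) \<and>
      bdd_below (c ` {x\<in>\<Omega>. w x < 0}) \<and>
      ereal (setdist (hyperplane e t) (hyperplane e \<tau>) powr (2 * s)) *
        (- (INF x\<in>{x\<in>\<Omega>. w x < 0}. ereal (c x))) < ereal ?C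
      \<longrightarrow>
      (\<forall>x\<in>\<Omega>. 0 \<le> w x) \<and>
      ((\<forall>x\<in>\<Omega>. w x = 0 \<longrightarrow> F_op s \<theta> \<Theta> e w x \<le> 0) \<longrightarrow>
        (\<forall>x\<in>\<Omega>. 0 < w x) \<or> (AE x in lebesgue. w x = 0))"
      (is "\<forall>\<Theta> e t \<tau> H \<Omega> w c. ?P \<Theta> e t \<tau> H \<Omega> w c \<longrightarrow> ?Q \<Theta> e \<Omega> w")
    proof (intro allI impI)
      fix \<Theta> and e :: "real^'n" and t \<tau> H \<Omega> w c
      assume P: "?P \<Theta> e t \<tau> H \<Omega> w c"
      \<comment> \<open>The lower half-space for (e, t) is the upper one for (-e, -t); the operator,
        the reflection, the hyperplanes and the slab are unchanged when all signs are
        reversed.\<close>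
      then consider "H = {x. t < e \<bullet> x}" | "H = {x. - t < (- e) \<bullet> x}" by auto
      then show "?Q \<Theta> e \<Omega> w"
      proof cases
        case 1
        show ?thesis
          by (rule half_space_case[where e = e and t = t and \<tau> = \<tau> and c = c and s = s and \<theta> = \<theta> and \<Theta> = \<Theta>])
            (use P assms 1 in auto)
      next
        case 2
        have "?Q \<Theta> (- e) \<Omega> w"
          by (rule half_space_case[where e = "- e" and t = "- t" and \<tau> = "- \<tau>" and c = c and s = s and \<theta> = \<theta> and \<Theta> = \<Theta>])
            (use P assms 2 in \<open>auto simp: hyperplane_minus F_op_minus reflect_minus region_between_minus\<close>)
        then show ?thesis by (simp only: F_op_minus)
      qed
    qed
  qed
qed

end
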